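(* For $n\ge1$ let $\mu_n=\frac Tn\sum_{i=0}^{n-1}\delta_{iT/n}$, $\mathrm{supp}(\mu_n)=\{0,\frac Tn,\dots,\frac{(n-1)T}{n}\}$, and \[ f_n(t,x)=\mathbb{E}\Big[\exp\Big(\int_t^T\sum_{i=1}^3u_i(s)p_i(X_s)\mu_n(ds)+v(T)q(X_T)\Big)\,\Big|\,X_t=x\Big]. \] Then for $j=0,1,\dots,n-1$: (i) $f_n$ is continuous on $(\frac{jT}{n},\frac{(j+1)T}{n}]\times\mathbb{R}$, and $f_n$ is $C^1$ in $t$ and $C^\infty$ in $x$ on $(\frac{jT}{n},\frac{(j+1)T}{n})\times\mathbb{R}$; (ii) $f_n$ solves \[ (f_n)_t+(f_n)_x(a+bx)+\tfrac12c^2(f_n)_{xx}=0,\quad t\notin\mathrm{supp}(\mu_n)\cup\{T\}, \] \[ \lim_{s\to t^+}f_n(s,x)=f_n(t,x)\exp\Big(-\tfrac Tn\sum_{i=1}^3u_i(t)p_i(x)\Big),\quad t\in\mathrm{supp}(\mu_n),\qquad f_n(T,x)=\exp(v(T)q(x)). \]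
   Context: Let $W$ be a Brownian motion; $a,b\in\mathbb{R}$, $c\ne0$, $T>0$; $dX_t=(a+bX_t)dt+c\,dW_t$. Negligible to double factorial: $\limsup_k(|p_k|(k-1)!!)^{1/k}=0$, $(-1)!!=0!!=1$. Standing assumptions: $u_1,u_2,u_3,v:[0,T]\to\mathbb{C}$ continuous with $\Re(u_1)\le0$, $\Re(u_2)=\Re(u_3)=\Re(v)=0$; $p_1=p^2$ for a real-coefficient power series $p$ negligible to double factorial; $p_2,p_3,q$ real-coefficient power series negligible to double factorial. "$C^\infty$ in $x$": all $x$-derivatives exist and are jointly continuous; "$C^1$ in $t$": $\partial_t$ exists and is jointly continuous. *)

theory Defs
  imports "HOL-Probability.Probability"
begin

fun double_factorial :: "nat \<Rightarrow> nat" where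
  "double_factorial 0 = 1"
| "double_factorial (Suc 0) = 1"
| "double_factorial (Suc (Suc n)) = (n + 2) * double_factorial n"

text \<open>(k-1)!! with the convention (-1)!! = 1.\<close>
definition dfact_pred :: "nat \<Rightarrow> real" where
  "dfact_pred k = (if k = 0 then 1 else real (double_factorial (k - 1)))"

definition negligible_df :: "(nat \<Rightarrow> real) \<Rightarrow> bool" where
  "negligible_df c \<longleftrightarrow>
     limsup (\<lambda>k. ereal (root k (\<bar>c k\<bar> * dfact_pred k))) = 0"

definition pseries :: "(nat \<Rightarrow> real) \<Rightarrow> real \<Rightarrow> real" where
  "pseries c x = (\<Sum>k. c k * x ^ k)"

definition pseries_sq :: "(nat \<Rightarrow> real) \<Rightarrow> nat \<Rightarrow> real" where
  "pseries_sq c k = (\<Sum>i\<le>k. c i * c (k - i))"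

definition brownian_motion :: "'a measure \<Rightarrow> (real \<Rightarrow> 'a \<Rightarrow> real) \<Rightarrow> bool" where
  "brownian_motion M W \<longleftrightarrow>
     prob_space M
   \<and> (\<forall>t\<ge>0. W t \<in> borel_measurable M)
   \<and> (AE \<omega> in M. W 0 \<omega> = 0 \<and> continuous_on {0..} (\<lambda>t. W t \<omega>))
   \<and> (\<forall>s t. 0 \<le> s \<and> s < t \<longrightarrow>
        distributed M lborel (\<lambda>\<omega>. W t \<omega> - W s \<omega>) (normal_density 0 (sqrt (t - s))))
   \<and> (\<forall>(ts :: nat \<Rightarrow> real) k. 0 \<le> ts 0 \<and> (\<forall>i<k. ts i \<le> ts (Suc i)) \<longrightarrow>
        prob_space.indep_vars M (\<lambda>_. borel) (\<lambda>i \<omega>. W (ts (Suc i)) \<omega> - W (ts i) \<omega>) {..<k})"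

definition C1_in_t :: "(real \<times> real) set \<Rightarrow> (real \<Rightarrow> real \<Rightarrow> complex) \<Rightarrow> bool" where
  "C1_in_t S f \<longleftrightarrow> (\<exists>ft. (\<forall>(t, x)\<in>S. ((\<lambda>s. f s x) has_vector_derivative ft t x) (at t))
                         \<and> continuous_on S (\<lambda>(t, x). ft t x))"

definition Cinf_in_x :: "(real \<times> real) set \<Rightarrow> (real \<Rightarrow> real \<Rightarrow> complex) \<Rightarrow> bool" where
  "Cinf_in_x S f \<longleftrightarrow> (\<exists>D :: nat \<Rightarrow> real \<Rightarrow> real \<Rightarrow> complex.
       (\<forall>(t, x)\<in>S. D 0 t x = f t x)
     \<and> (\<forall>k. \<forall>(t, x)\<in>S. ((\<lambda>y. D k t y) has_vector_derivative D (Suc k) t x) (at x))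
     \<and> (\<forall>k. continuous_on S (\<lambda>(t, x). D k t x)))"

end

theory Submission
  imports Defs
begin

text \<open>
  Write \<open>t\<^sub>i = i T / n\<close> and \<open>r = t\<^sub>j\<^sub>+\<^sub>1\<close>. For a solution \<open>X\<close> of the linear equation the weighted sums
  \<open>\<Sum>\<^sub>k c e\<^bsup>b (s - s\<^sub>k)\<^esup> (W(s\<^sub>k\<^sub>+\<^sub>1) - W(s\<^sub>k))\<close> over finer and finer partitions of \<open>[r, s]\<close> converge pathwise to
  \<open>X\<^sub>s - e\<^bsup>b (s - r)\<^esup> X\<^sub>r - a (e\<^bsup>b (s - r)\<^esup> - 1) / b\<close>. These sums are Gaussian, and sums over adjacent intervals are independent.
  Since only expectations of bounded continuous functions are involved, dominated convergence carries both
  facts to the limit, without characteristic functions or generated sigma-algebras. It follows that on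
  \<open>(t\<^sub>j, r]\<close> the function \<open>f\<^sub>n\<close> is the average of the bounded continuous function \<open>F = f\<^sub>n(r, \<cdot>)\<close> against a
  Gaussian whose mean and variance are explicit in \<open>(t, x)\<close>. Regularity and the equation are then read off
  the integrals \<open>\<integral> F(y) (y - m)\<^sup>k exp (- (y - m)\<^sup>2 / (2 v)) dy\<close>, a family closed under differentiation.
\<close>

section \<open>Pathwise solution of the linear equation\<close>

text \<open>Conditioning on X_t = x is encoded by a family of solutions \<open>X t x\<close>, each
  valid off its own null set and measurable in \<omega> at fixed times. Inserting a random state for
  \<open>x\<close> is therefore not meaningful as it stands, and the Markov property cannot be
  phrased as a restart of the family at a random point. Linearity removes the obstacle: after time r
  every solution equals e^(b (s - r)) times its value at r plus the one process
  \<open>X r 0\<close>, so the state enters through an explicit affine map. The bound 1 behind the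
  dominated convergence arguments comes from the signs: p_1 = p^2 with Re u_1 <= 0, while the other
  exponents are purely imaginary. Gaussian averages appear in two forms. Parametrised by the
  standard deviation they still make sense at 0, which gives continuity up to the endpoint r.
  Parametrised by a positive variance, with an unnormalised kernel, they can be differentiated.
  \<open>F\<close> is merely continuous and bounded; smoothness in x comes from the kernel, and c
  \<noteq> 0 keeps the variance positive before r.\<close>

definition expm1_quot :: "real \<Rightarrow> real \<Rightarrow> real" where
  "expm1_quot b s = (if b = 0 then s else (exp (b * s) - 1) / b)"

lemma expm1_quot_0 [simp]: "expm1_quot b 0 = 0"
  by (simp add: expm1_quot_def)

lemma expm1_quot_pos: "0 < s \<Longrightarrow> 0 < expm1_quot b s"
  by (cases b "0 :: real" rule: linorder_cases)
     (auto simp: expm1_quot_def divide_simps mult_neg_pos)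

lemma mult_expm1_quot: "b * expm1_quot b s = exp (b * s) - 1"
  by (simp add: expm1_quot_def)

text \<open>Together with the value 0 at 0 this identifies \<open>expm1_quot b s\<close> as the
  integral of e^(b u) over [0, s], the case \<open>b = 0\<close> included. With parameter
  \<open>b\<close> it enters the mean of the process, with \<open>2 * b\<close> the
  variance.\<close>

lemma has_real_derivative_expm1_quot [derivative_intros]:
  assumes "(g has_real_derivative g') (at x within S)"
  shows "((\<lambda>x. expm1_quot b (g x)) has_real_derivative exp (b * g x) * g') (at x within S)"
  using assms unfolding expm1_quot_def
  by (cases "b = 0") (auto intro!: derivative_eq_intros)

lemma continuous_on_expm1_quot [continuous_intros]:
  fixes g :: "'a::topological_space \<Rightarrow> real"
  assumes "continuous_on S g"
  shows "continuous_on S (\<lambda>x. expm1_quot b (g x))"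
  using assms unfolding expm1_quot_def
  by (cases "b = 0") (auto intro!: continuous_intros)

text \<open>Variation of constants on a single step, with the exponential weight frozen at the left
  end. The discrepancy is an integral over the step whose integrand would vanish if \<open>y\<close>
  and \<open>E\<close> were constant there; hence the factor \<open>e\<close> in addition to the
  length \<open>v - u\<close>.\<close>

lemma ou_step_error:
  fixes y w :: "real \<Rightarrow> real" and a b c s :: real
  defines "E \<equiv> \<lambda>u. exp (b * (s - u))"
  assumes uv: "u \<le> v" and cont: "continuous_on {u..v} y"
    and step: "y v - y u = integral {u..v} (\<lambda>r. a + b * y r) + c * (w v - w u)"
    and dy: "\<And>r. r \<in> {u..v} \<Longrightarrow> \<bar>y v - y r\<bar> \<le> e"
    and dE: "\<And>r. r \<in> {u..v} \<Longrightarrow> \<bar>E r - E u\<bar> \<le> e"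
    and bE: "\<And>r. r \<in> {u..v} \<Longrightarrow> \<bar>E r\<bar> \<le> C"
    and bY: "\<And>r. r \<in> {u..v} \<Longrightarrow> \<bar>y r\<bar> \<le> C"
  shows "\<bar>c * E u * (w v - w u)
      - ((E v * y v + a * expm1_quot b (s - v)) - (E u * y u + a * expm1_quot b (s - u)))\<bar>
    \<le> (\<bar>a\<bar> + 2 * \<bar>b\<bar> * C) * e * (v - u)"
proof -
  have "((\<lambda>r. a + b * y r) has_integral integral {u..v} (\<lambda>r. a + b * y r)) {u..v}"
    by (intro integrable_integral integrable_continuous_real continuous_intros cont)
  hence I1: "((\<lambda>r. E u * (a + b * y r)) has_integral E u * integral {u..v} (\<lambda>r. a + b * y r)) {u..v}"
    by (rule has_integral_mult_right)
  have "((\<lambda>r. b * E r) has_integral (- E v) - (- E u)) {u..v}"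
    unfolding E_def using uv
    by (intro fundamental_theorem_of_calculus)
       (auto intro!: derivative_eq_intros simp: has_real_derivative_iff_has_vector_derivative[symmetric])
  hence I2: "((\<lambda>r. y v * (b * E r)) has_integral y v * ((- E v) - (- E u))) {u..v}"
    by (rule has_integral_mult_right)
  have "((\<lambda>r. E r) has_integral (- expm1_quot b (s - v)) - (- expm1_quot b (s - u))) {u..v}"
    unfolding E_def using uv
    by (intro fundamental_theorem_of_calculus)
       (auto intro!: derivative_eq_intros simp: has_real_derivative_iff_has_vector_derivative[symmetric])
  hence I3: "((\<lambda>r. a * E r) has_integral a * ((- expm1_quot b (s - v)) - (- expm1_quot b (s - u)))) {u..v}"
    by (rule has_integral_mult_right)
  \<comment> \<open>The equation \<open>step\<close> trades the increment of \<open>w\<close> for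
    quantities of \<open>y\<close>; what remains consists of integrals over the step, which
    \<open>I1\<close>, \<open>I2\<close> and \<open>I3\<close> evaluate.\<close>
  have eq: "c * E u * (w v - w u)
      - ((E v * y v + a * expm1_quot b (s - v)) - (E u * y u + a * expm1_quot b (s - u)))
      = y v * ((- E v) - (- E u)) - E u * integral {u..v} (\<lambda>r. a + b * y r)
        + a * ((- expm1_quot b (s - v)) - (- expm1_quot b (s - u)))"
  proof -
    have "c * (w v - w u) = y v - y u - integral {u..v} (\<lambda>r. a + b * y r)"
      using step by simp
    hence "c * E u * (w v - w u) = E u * (y v - y u - integral {u..v} (\<lambda>r. a + b * y r))"
      by (metis mult.assoc mult.commute)
    thus ?thesis by (simp add: algebra_simps)
  qed
  have I: "((\<lambda>r. y v * (b * E r) - E u * (a + b * y r) + a * E r) has_integral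
      c * E u * (w v - w u)
      - ((E v * y v + a * expm1_quot b (s - v)) - (E u * y u + a * expm1_quot b (s - u)))) {u..v}"
    unfolding eq by (intro has_integral_add has_integral_diff I1 I2 I3)
  have C0: "0 \<le> C" and e0: "0 \<le> e"
    using bY[of u] dy[of u] uv by (auto intro: order_trans[OF abs_ge_zero])
  have "norm (c * E u * (w v - w u)
      - ((E v * y v + a * expm1_quot b (s - v)) - (E u * y u + a * expm1_quot b (s - u))))
    \<le> (\<bar>a\<bar> + 2 * \<bar>b\<bar> * C) * e * Henstock_Kurzweil_Integration.content {u..v}"
  proof (rule has_integral_bound_real[OF _ finite.emptyI I])
    show "0 \<le> (\<bar>a\<bar> + 2 * \<bar>b\<bar> * C) * e" using C0 e0 by simp
    fix r assume "r \<in> {u..v} - {}"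
    hence r: "r \<in> {u..v}" by simp
    \<comment> \<open>Adding and subtracting \<open>b * E r * y r\<close> leaves one small
      oscillation of \<open>y\<close> or \<open>E\<close> in each term.\<close>
    have "y v * (b * E r) - E u * (a + b * y r) + a * E r
        = a * (E r - E u) + b * (E r * (y v - y r)) + b * (y r * (E r - E u))"
      by (simp add: algebra_simps)
    also have "norm \<dots> \<le> \<bar>a\<bar> * \<bar>E r - E u\<bar> + \<bar>b\<bar> * (\<bar>E r\<bar> * \<bar>y v - y r\<bar>) + \<bar>b\<bar> * (\<bar>y r\<bar> * \<bar>E r - E u\<bar>)"
      by (simp only: abs_mult[symmetric] real_norm_def)
    also have "\<dots> \<le> \<bar>a\<bar> * e + \<bar>b\<bar> * (C * e) + \<bar>b\<bar> * (C * e)"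
      using dy[OF r] dE[OF r] bE[OF r] bY[OF r] C0
      by (intro add_mono mult_left_mono mult_mono) auto
    also have "\<dots> = (\<bar>a\<bar> + 2 * \<bar>b\<bar> * C) * e" by (simp add: algebra_simps)
    finally show "norm (y v * (b * E r) - E u * (a + b * y r) + a * E r) \<le> (\<bar>a\<bar> + 2 * \<bar>b\<bar> * C) * e" .
  qed
  thus ?thesis using uv by simp
qed

section \<open>Exponentially weighted sums of increments\<close>

definition grid :: "real \<Rightarrow> real \<Rightarrow> nat \<Rightarrow> nat \<Rightarrow> real" where
  "grid r s N k = r + real k * (s - r) / real N"

lemma grid_0 [simp]: "grid r s N 0 = r"
  by (simp add: grid_def)

lemma grid_self [simp]: "0 < N \<Longrightarrow> grid r s N N = s"
  by (simp add: grid_def)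

lemma grid_Suc_diff: "grid r s N (Suc k) - grid r s N k = (s - r) / real N"
  by (simp add: grid_def distrib_right add_divide_distrib)

lemma grid_mono: "r \<le> s \<Longrightarrow> k \<le> l \<Longrightarrow> grid r s N k \<le> grid r s N l"
  unfolding grid_def by (intro add_left_mono divide_right_mono mult_right_mono) auto

lemma grid_in: "r \<le> s \<Longrightarrow> k \<le> N \<Longrightarrow> grid r s N k \<in> {r..s}"
  using grid_mono[of r s 0 k N] grid_mono[of r s k N N] by (cases "N = 0") auto

text \<open>Left-endpoint sums for the Wiener integral of c e^(b (s - u)) over [r, s]. The driver is
  an arbitrary path, so the same expression serves for a Brownian path and, with
  \<open>w u = u\<close>, as the Riemann sum behind the variance.\<close>

definition ou_sum :: "real \<Rightarrow> real \<Rightarrow> (real \<Rightarrow> real) \<Rightarrow> real \<Rightarrow> real \<Rightarrow> nat \<Rightarrow> real" where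
  "ou_sum b c w r s N =
     (\<Sum>k<N. c * exp (b * (s - grid r s N k)) * (w (grid r s N (Suc k)) - w (grid r s N k)))"

text \<open>\<open>Q\<close> is chosen so that its increments telescope to the claimed limit; by
  uniform continuity the one-step errors add up to at most \<open>e * B\<close>. The statement is
  deterministic and is applied path by path.\<close>

lemma ou_sum_tendsto:
  fixes y w :: "real \<Rightarrow> real"
  assumes rs: "r \<le> s" and cont: "continuous_on {r..s} y"
    and sol: "\<And>u. u \<in> {r..s} \<Longrightarrow> y u = x + integral {r..u} (\<lambda>v. a + b * y v) + c * (w u - w r)"
  shows "(\<lambda>N. ou_sum b c w r s N) \<longlonglongrightarrow> y s - exp (b * (s - r)) * x - a * expm1_quot b (s - r)"
proof -
  define E where "E = (\<lambda>u. exp (b * (s - u)))"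
  define Q where "Q = (\<lambda>u. E u * y u + a * expm1_quot b (s - u))"
  have contE: "continuous_on {r..s} E" unfolding E_def by (intro continuous_intros)
  have yr: "y r = x" using sol[of r] rs by simp
  have Qd: "Q s - Q r = y s - exp (b * (s - r)) * x - a * expm1_quot b (s - r)"
    by (simp add: Q_def E_def yr)
  have step: "y v - y u = integral {u..v} (\<lambda>r. a + b * y r) + c * (w v - w u)"
    if "r \<le> u" "u \<le> v" "v \<le> s" for u v
  proof -
    have "(\<lambda>v. a + b * y v) integrable_on {r..v}"
      by (intro integrable_continuous_real continuous_intros continuous_on_subset[OF cont]) (use that in auto)
    hence "integral {r..v} (\<lambda>v. a + b * y v) = integral {r..u} (\<lambda>v. a + b * y v) + integral {u..v} (\<lambda>v. a + b * y v)"
      using Henstock_Kurzweil_Integration.integral_combine[of r u v "\<lambda>v. a + b * y v"] that by simp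
    thus ?thesis using sol[of u] sol[of v] that by (simp add: algebra_simps)
  qed
  obtain C1 where C1: "\<And>u. u \<in> {r..s} \<Longrightarrow> \<bar>y u\<bar> \<le> C1"
    using compact_continuous_image[OF cont compact_Icc, THEN compact_imp_bounded]
    unfolding bounded_iff by (force simp del: atLeastAtMost_iff)
  obtain C2 where C2: "\<And>u. u \<in> {r..s} \<Longrightarrow> \<bar>E u\<bar> \<le> C2"
    using compact_continuous_image[OF contE compact_Icc, THEN compact_imp_bounded]
    unfolding bounded_iff by (force simp del: atLeastAtMost_iff)
  define C where "C = max C1 C2"
  define B where "B = (\<bar>a\<bar> + 2 * \<bar>b\<bar> * C) * (s - r)"
  have C0: "0 \<le> C" using C1[of r] rs unfolding C_def by auto
  have B0: "0 \<le> B" unfolding B_def using C0 rs by simp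
  have "(\<lambda>N. ou_sum b c w r s N) \<longlonglongrightarrow> Q s - Q r"
  proof (rule LIMSEQ_I)
    fix \<epsilon> :: real assume \<epsilon>: "0 < \<epsilon>"
    \<comment> \<open>The \<open>+ 1\<close> keeps the denominator positive when
      \<open>B = 0\<close>, for instance when \<open>r = s\<close>.\<close>
    define e where "e = \<epsilon> / (B + 1)"
    have e: "0 < e" "e * B < \<epsilon>" using \<epsilon> B0 by (auto simp: e_def field_simps)
    obtain d1 where d1: "0 < d1" "\<And>u v. u \<in> {r..s} \<Longrightarrow> v \<in> {r..s} \<Longrightarrow> dist v u < d1 \<Longrightarrow> dist (y v) (y u) < e"
      using compact_uniformly_continuous[OF cont compact_Icc] e(1) unfolding uniformly_continuous_on_def by metis
    obtain d2 where d2: "0 < d2" "\<And>u v. u \<in> {r..s} \<Longrightarrow> v \<in> {r..s} \<Longrightarrow> dist v u < d2 \<Longrightarrow> dist (E v) (E u) < e"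
      using compact_uniformly_continuous[OF contE compact_Icc] e(1) unfolding uniformly_continuous_on_def by metis
    have "(\<lambda>N. (s - r) / real N) \<longlonglongrightarrow> 0" by (rule lim_const_over_n)
    hence "eventually (\<lambda>N. (s - r) / real N < min d1 d2) sequentially"
      using d1 d2 by (intro order_tendstoD) auto
    hence ev: "eventually (\<lambda>N. (s - r) / real N < min d1 d2 \<and> 0 < N) sequentially"
      using eventually_gt_at_top[of 0] by eventually_elim auto
    have bound: "norm (ou_sum b c w r s N - (Q s - Q r)) < \<epsilon>" if N: "(s - r) / real N < min d1 d2 \<and> 0 < N" for N
    proof -
      let ?g = "grid r s N"
      have "(\<Sum>k<N. Q (?g (Suc k)) - Q (?g k)) = Q s - Q r"
        using N by (subst sum_lessThan_telescope) auto
      hence eq: "ou_sum b c w r s N - (Q s - Q r)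
         = (\<Sum>k<N. c * E (?g k) * (w (?g (Suc k)) - w (?g k)) - (Q (?g (Suc k)) - Q (?g k)))"
        by (simp add: ou_sum_def E_def sum_subtractf)
      have "norm (ou_sum b c w r s N - (Q s - Q r)) \<le> (\<Sum>k<N. (\<bar>a\<bar> + 2 * \<bar>b\<bar> * C) * e * (?g (Suc k) - ?g k))"
        unfolding eq
      proof (rule sum_norm_le)
        fix k assume "k \<in> {..<N}"
        hence k: "?g k \<in> {r..s}" "?g (Suc k) \<in> {r..s}" using rs by (auto intro!: grid_in simp del: atLeastAtMost_iff)
        have le: "?g k \<le> ?g (Suc k)" using rs by (intro grid_mono) auto
        \<comment> \<open>Both endpoints matter: \<open>E\<close> is compared with its value at the
          left end, \<open>y\<close> with its value at the right end.\<close>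
        have sub: "u \<in> {r..s}" and near: "dist u (?g k) < min d1 d2" "dist u (?g (Suc k)) < min d1 d2"
          if "u \<in> {?g k..?g (Suc k)}" for u
          using that k N grid_Suc_diff[of r s N k] by (auto simp: dist_real_def)
        show "norm (c * E (?g k) * (w (?g (Suc k)) - w (?g k)) - (Q (?g (Suc k)) - Q (?g k)))
           \<le> (\<bar>a\<bar> + 2 * \<bar>b\<bar> * C) * e * (?g (Suc k) - ?g k)"
          unfolding Q_def E_def real_norm_def
        proof (rule ou_step_error[OF le])
          show "continuous_on {?g k..?g (Suc k)} y"
            by (rule continuous_on_subset[OF cont]) (use sub in auto)
          show "y (?g (Suc k)) - y (?g k) = integral {?g k..?g (Suc k)} (\<lambda>r. a + b * y r) + c * (w (?g (Suc k)) - w (?g k))"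
            by (rule step) (use k le in auto)
          fix u assume u: "u \<in> {?g k..?g (Suc k)}"
          show "\<bar>y (?g (Suc k)) - y u\<bar> \<le> e"
            using d1(2)[OF k(2) sub[OF u]] near(2)[OF u] by (auto simp: dist_real_def abs_minus_commute)
          show "\<bar>exp (b * (s - u)) - exp (b * (s - ?g k))\<bar> \<le> e"
            using d2(2)[OF k(1) sub[OF u]] near(1)[OF u] by (auto simp: dist_real_def E_def)
          show "\<bar>exp (b * (s - u))\<bar> \<le> C" using C2[OF sub[OF u]] by (auto simp: C_def E_def)
          show "\<bar>y u\<bar> \<le> C" using C1[OF sub[OF u]] by (auto simp: C_def)
        qed
      qed
      also have "\<dots> = (\<bar>a\<bar> + 2 * \<bar>b\<bar> * C) * e * (s - r)"
        using conjunct2[OF N] by (simp add: grid_Suc_diff)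
      also have "\<dots> = e * B" by (simp add: B_def)
      finally show ?thesis using e(2) by simp
    qed
    from ev obtain N0 where "\<And>N. N0 \<le> N \<Longrightarrow> (s - r) / real N < min d1 d2 \<and> 0 < N"
      by (auto simp: eventually_sequentially)
    thus "\<exists>N0. \<forall>N\<ge>N0. norm (ou_sum b c w r s N - (Q s - Q r)) < \<epsilon>"
      using bound by blast
  qed
  thus ?thesis by (simp only: Qd)
qed

text \<open>The function \<open>expm1_quot b\<close> itself solves the equation driven by \<open>w u = u\<close>.\<close>
lemma ou_sum_id_tendsto:
  assumes rs: "r \<le> s"
  shows "(\<lambda>N. ou_sum b 1 (\<lambda>u. u) r s N) \<longlonglongrightarrow> expm1_quot b (s - r)"
proof -
  have "(\<lambda>N. ou_sum b 1 (\<lambda>u. u) r s N) \<longlonglongrightarrow>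
     expm1_quot b (s - r) - exp (b * (s - r)) * 0 - 0 * expm1_quot b (s - r)"
  proof (rule ou_sum_tendsto[OF rs])
    show "continuous_on {r..s} (\<lambda>u. expm1_quot b (u - r))" by (intro continuous_intros)
    fix u assume u: "u \<in> {r..s}"
    have "((\<lambda>v. exp (b * (v - r)) - 1) has_integral
       (expm1_quot b (u - r) - u) - (expm1_quot b (r - r) - r)) {r..u}"
      using u by (intro fundamental_theorem_of_calculus)
       (auto intro!: derivative_eq_intros simp: has_real_derivative_iff_has_vector_derivative[symmetric])
    hence "integral {r..u} (\<lambda>v. 0 + b * expm1_quot b (v - r)) = expm1_quot b (u - r) - (u - r)"
      by (subst mult_expm1_quot) (simp add: integral_unique)
    thus "expm1_quot b (u - r) = 0 + integral {r..u} (\<lambda>v. 0 + b * expm1_quot b (v - r)) + 1 * (u - r)"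
      by simp
  qed
  thus ?thesis by simp
qed

section \<open>Power series negligible to double factorial\<close>

lemma double_factorial_pos: "0 < double_factorial k"
  by (induction k rule: double_factorial.induct) auto

text \<open>The weight (k-1)!! is at least 1, so the limsup in the Cauchy-Hadamard formula lies
  between 0 and the one in \<open>negligible_df\<close>.\<close>

lemma conv_radius_negligible_df:
  assumes "negligible_df c"
  shows "conv_radius c = \<infinity>"
proof -
  have dp: "1 \<le> dfact_pred k" for k
    using double_factorial_pos[of "k - 1"] by (auto simp: dfact_pred_def Suc_le_eq)
  have "root k \<bar>c k\<bar> \<le> root k (\<bar>c k\<bar> * dfact_pred k)" for k
  proof (cases "k = 0")
    case False
    have "\<bar>c k\<bar> * 1 \<le> \<bar>c k\<bar> * dfact_pred k" by (intro mult_left_mono dp) auto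
    thus ?thesis using False by simp
  qed simp
  hence "limsup (\<lambda>k. ereal (root k (norm (c k)))) \<le> limsup (\<lambda>k. ereal (root k (\<bar>c k\<bar> * dfact_pred k)))"
    by (intro Limsup_mono) auto
  also have "\<dots> = 0" using assms by (simp add: negligible_df_def)
  finally have "limsup (\<lambda>k. ereal (root k (norm (c k)))) \<le> 0" .
  moreover have "limsup (\<lambda>k. ereal (root k (norm (c k)))) \<ge> 0"
    by (rule le_Limsup) (auto intro!: always_eventually real_root_ge_zero)
  ultimately have "limsup (\<lambda>k. ereal (root k (norm (c k)))) = 0" by (rule antisym)
  thus ?thesis by (simp add: conv_radius_def)
qed

lemma summable_norm_negligible_df:
  assumes "negligible_df c"
  shows "summable (\<lambda>k. norm (c k * x ^ k))"
  by (rule abs_summable_in_conv_radius) (simp add: conv_radius_negligible_df[OF assms])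

lemma continuous_pseries:
  assumes "negligible_df c"
  shows "continuous_on UNIV (pseries c)"
proof -
  have "isCont (\<lambda>x. \<Sum>n. c n * x ^ n) x" for x
    by (rule isCont_powser_converges_everywhere)
       (rule summable_norm_cancel[OF summable_norm_negligible_df[OF assms]])
  thus ?thesis unfolding pseries_def[abs_def] by (simp add: continuous_on_eq_continuous_at)
qed

text \<open>Cauchy product of an absolutely convergent series with itself. It turns the
  coefficientwise identity p_1 = p^2 into a pointwise square, on which the sign of Re (u_1 p_1)
  rests.\<close>

lemma pseries_pseries_sq:
  assumes "negligible_df c"
  shows "pseries (pseries_sq c) x = (pseries c x)\<^sup>2"
proof -
  have "pseries c x * pseries c x = (\<Sum>k. \<Sum>i\<le>k. (c i * x ^ i) * (c (k - i) * x ^ (k - i)))"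
    unfolding pseries_def using summable_norm_negligible_df[OF assms] by (intro Cauchy_product) auto
  also have "\<dots> = pseries (pseries_sq c) x"
    unfolding pseries_def pseries_sq_def
  proof (intro suminf_cong)
    fix k
    show "(\<Sum>i\<le>k. (c i * x ^ i) * (c (k - i) * x ^ (k - i))) = (\<Sum>i\<le>k. c i * c (k - i)) * x ^ k"
      unfolding sum_distrib_right
      by (intro sum.cong refl) (simp add: power_add[symmetric] mult.assoc mult.left_commute)
  qed
  finally show ?thesis by (simp add: power2_eq_square)
qed

section \<open>Gaussian moments of a bounded function\<close>

lemma has_vector_derivative_iff_quotient:
  fixes g :: "real \<Rightarrow> 'a::real_normed_vector"
  shows "(g has_vector_derivative D) (at x) \<longleftrightarrow> ((\<lambda>t. (g t - g x) /\<^sub>R (t - x)) \<longlongrightarrow> D) (at x)"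
proof -
  have "(g has_vector_derivative D) (at x) \<longleftrightarrow>
      ((\<lambda>t. norm (g t - g x - (t - x) *\<^sub>R D) / norm (t - x)) \<longlongrightarrow> 0) (at x)"
    unfolding has_vector_derivative_def has_derivative_iff_norm
    by (simp add: bounded_linear_scaleR_left)
  also have "\<dots> \<longleftrightarrow> ((\<lambda>t. norm ((g t - g x) /\<^sub>R (t - x) - D)) \<longlongrightarrow> 0) (at x)"
  proof (rule tendsto_cong)
    have "norm (g t - g x - (t - x) *\<^sub>R D) / norm (t - x) = norm ((g t - g x) /\<^sub>R (t - x) - D)"
      if "t \<noteq> x" for t
    proof -
      have "(g t - g x) /\<^sub>R (t - x) - D = (g t - g x - (t - x) *\<^sub>R D) /\<^sub>R (t - x)"
        using that by (simp add: scaleR_diff_right)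
      thus ?thesis by (simp add: divide_inverse mult.commute)
    qed
    thus "\<forall>\<^sub>F t in at x. norm (g t - g x - (t - x) *\<^sub>R D) / norm (t - x) = norm ((g t - g x) /\<^sub>R (t - x) - D)"
      by (auto simp: eventually_at_filter)
  qed
  also have "\<dots> \<longleftrightarrow> ((\<lambda>t. (g t - g x) /\<^sub>R (t - x)) \<longlongrightarrow> D) (at x)"
    by (simp add: tendsto_norm_zero_iff LIM_zero_iff)
  finally show ?thesis .
qed

text \<open>By the mean value inequality the bound \<open>B\<close> on the derivative also dominates
  all difference quotients. Dominated convergence works along sequences, which is why the derivative
  is recast as a limit of quotients.\<close>

lemma has_vector_derivative_lebesgue_integral:
  fixes g g' :: "real \<Rightarrow> 'b \<Rightarrow> 'c::{banach, second_countable_topology}"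
  assumes x: "x \<in> {l<..<u}"
    and deriv: "\<And>t y. t \<in> {l<..<u} \<Longrightarrow> y \<in> space M \<Longrightarrow> ((\<lambda>t. g t y) has_vector_derivative g' t y) (at t)"
    and int: "\<And>t. t \<in> {l<..<u} \<Longrightarrow> integrable M (g t)"
    and meas: "g' x \<in> borel_measurable M"
    and bound: "\<And>t y. t \<in> {l<..<u} \<Longrightarrow> y \<in> space M \<Longrightarrow> norm (g' t y) \<le> B y"
    and intB: "integrable M B"
  shows "((\<lambda>t. integral\<^sup>L M (g t)) has_vector_derivative integral\<^sup>L M (g' x)) (at x)"
proof -
  have lip: "norm (g t y - g x y) \<le> B y * \<bar>t - x\<bar>" if t: "t \<in> {l<..<u}" and y: "y \<in> space M" for t y
  proof -
    have "norm (g t y - g x y) \<le> B y * norm (t - x)"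
    proof (rule differentiable_bound[of "{l<..<u}"])
      show "((\<lambda>t. g t y) has_derivative (\<lambda>h. h *\<^sub>R g' s y)) (at s within {l<..<u})" if "s \<in> {l<..<u}" for s
        using deriv[OF that y] unfolding has_vector_derivative_def by (rule has_derivative_at_withinI)
      show "onorm (\<lambda>h. h *\<^sub>R g' s y) \<le> B y" if "s \<in> {l<..<u}" for s
        using bound[OF that y] by (intro onorm_le) (simp add: mult.commute[of "B y"] mult_left_mono)
    qed (use t x in auto)
    thus ?thesis by simp
  qed
  have "((\<lambda>t. (integral\<^sup>L M (g t) - integral\<^sup>L M (g x)) /\<^sub>R (t - x)) \<longlongrightarrow> integral\<^sup>L M (g' x))
      (at x within {l<..<u})"
    unfolding tendsto_at_iff_sequentially comp_def
  proof (intro allI impI)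
    fix X :: "nat \<Rightarrow> real" assume X: "\<forall>i. X i \<in> {l<..<u} - {x}" and lim: "X \<longlonglongrightarrow> x"
    have "(\<lambda>i. \<integral>y. (g (X i) y - g x y) /\<^sub>R (X i - x) \<partial>M) \<longlonglongrightarrow> integral\<^sup>L M (g' x)"
    proof (rule integral_dominated_convergence[where w = B])
      show "(\<lambda>y. (g (X i) y - g x y) /\<^sub>R (X i - x)) \<in> borel_measurable M" for i
        using X int x by (intro borel_measurable_scaleR borel_measurable_diff borel_measurable_integrable) auto
      show "AE y in M. (\<lambda>i. (g (X i) y - g x y) /\<^sub>R (X i - x)) \<longlonglongrightarrow> g' x y"
      proof (rule AE_I2)
        fix y assume y: "y \<in> space M"
        have "((\<lambda>t. (g t y - g x y) /\<^sub>R (t - x)) \<longlongrightarrow> g' x y) (at x)"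
          using deriv[OF x y] by (simp add: has_vector_derivative_iff_quotient)
        thus "(\<lambda>i. (g (X i) y - g x y) /\<^sub>R (X i - x)) \<longlonglongrightarrow> g' x y"
          using X lim unfolding tendsto_at_iff_sequentially comp_def by auto
      qed
      show "AE y in M. norm ((g (X i) y - g x y) /\<^sub>R (X i - x)) \<le> B y" for i
      proof (rule AE_I2)
        fix y assume y: "y \<in> space M"
        have "X i \<noteq> x" using X by auto
        moreover have "norm (g (X i) y - g x y) \<le> B y * \<bar>X i - x\<bar>"
          using lip X y by auto
        ultimately show "norm ((g (X i) y - g x y) /\<^sub>R (X i - x)) \<le> B y"
          by (simp only: norm_scaleR) (simp add: divide_simps)
      qed
    qed (use meas intB in auto)
    moreover have "(\<integral>y. (g (X i) y - g x y) /\<^sub>R (X i - x) \<partial>M)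
        = (integral\<^sup>L M (g (X i)) - integral\<^sup>L M (g x)) /\<^sub>R (X i - x)" for i
      using X x int by (simp add: Bochner_Integration.integral_diff)
    ultimately show "(\<lambda>i. (integral\<^sup>L M (g (X i)) - integral\<^sup>L M (g x)) /\<^sub>R (X i - x)) \<longlonglongrightarrow> integral\<^sup>L M (g' x)"
      by (simp only:)
  qed
  thus ?thesis
    using x by (simp add: has_vector_derivative_iff_quotient at_within_open[of x "{l<..<u}"])
qed

section \<open>Powers times Gaussian kernels\<close>

definition gauss_ker :: "nat \<Rightarrow> real \<Rightarrow> real \<Rightarrow> real \<Rightarrow> real" where
  "gauss_ker k v m y = (y - m) ^ k * exp (- (y - m)\<^sup>2 / (2 * v))"

text \<open>Without the factor (2 pi v)^(-1/2), differentiating in \<open>m\<close> or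
  \<open>v\<close> only shifts the index \<open>k\<close>. The normalising factor is carried
  separately, later as \<open>coef\<close>.\<close>

definition gauss_moment :: "(real \<Rightarrow> complex) \<Rightarrow> nat \<Rightarrow> real \<Rightarrow> real \<Rightarrow> complex" where
  "gauss_moment F k v m = (\<integral>y. gauss_ker k v m y *\<^sub>R F y \<partial>lborel)"

lemma gauss_ker_measurable [measurable]: "gauss_ker k v m \<in> borel_measurable borel"
  unfolding gauss_ker_def[abs_def] by measurable

text \<open>A majorant that is uniform over all variances up to \<open>w\<close> and all means up to
  \<open>R\<close>. The power is absorbed by z^k <= k! e^z, and the linear term in the exponent by
  part of the Gaussian decay.\<close>

lemma gauss_ker_bound:
  assumes v: "0 < v" "v \<le> w" and m: "\<bar>m\<bar> \<le> R"
  shows "\<bar>gauss_ker k v m y\<bar> \<le> fact k * exp (2 * w + R\<^sup>2 / (4 * w)) * exp (- y\<^sup>2 / (8 * w))"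
proof -
  define z where "z = \<bar>y - m\<bar>"
  have w: "0 < w" using v by simp
  have z0: "0 \<le> z" by (simp add: z_def)
  have z2: "(y - m)\<^sup>2 = z\<^sup>2" by (simp add: z_def)
  have "z ^ k / fact k \<le> exp z"
    using sum_le_suminf[OF sums_summable[OF exp_converges[of z]], of "{k}"] z0
      sums_unique[OF exp_converges[of z]]
    by (simp add: divide_inverse mult.commute)
  hence "z ^ k \<le> fact k * exp z" by (simp add: field_simps)
  moreover have "exp (- z\<^sup>2 / (2 * v)) \<le> exp (- z\<^sup>2 / (2 * w))"
    using v w by (auto simp: divide_simps mult_left_mono)
  ultimately have "\<bar>gauss_ker k v m y\<bar> \<le> fact k * exp z * exp (- z\<^sup>2 / (2 * w))"
    unfolding gauss_ker_def abs_mult power_abs z2 z_def[symmetric]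
    by (intro mult_mono) auto
  also have "\<dots> = fact k * exp (z - z\<^sup>2 / (2 * w))" by (simp add: exp_add[symmetric])
  also have "z - z\<^sup>2 / (2 * w) \<le> (2 * w + R\<^sup>2 / (4 * w)) + - y\<^sup>2 / (8 * w)"
  proof -
    \<comment> \<open>Two completed squares produce the constants: (z - 4 w)^2 >= 0 absorbs the
      linear term, and (y - 2 m)^2 >= 0 moves the centre from \<open>m\<close> to 0.\<close>
    have "8 * (w * z) - z\<^sup>2 \<le> 16 * w\<^sup>2"
      using zero_le_power2[of "z - 4 * w"] by (simp add: power2_diff power_mult_distrib algebra_simps)
    moreover have "y\<^sup>2 - 2 * m\<^sup>2 \<le> 2 * z\<^sup>2"
      using zero_le_power2[of "y - 2 * m"]
      by (simp add: z2[symmetric] power2_diff power_mult_distrib algebra_simps)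
    moreover have "m\<^sup>2 \<le> R\<^sup>2" using m by (metis abs_ge_zero power2_abs power_mono)
    ultimately have "8 * w * z - 4 * z\<^sup>2 \<le> 16 * w\<^sup>2 + 2 * R\<^sup>2 - y\<^sup>2"
      using zero_le_power2[of z] by linarith
    hence "(8 * w * z - 4 * z\<^sup>2) / (8 * w) \<le> (16 * w\<^sup>2 + 2 * R\<^sup>2 - y\<^sup>2) / (8 * w)"
      using w by (intro divide_right_mono) auto
    thus ?thesis using w by (simp add: diff_divide_distrib add_divide_distrib power2_eq_square)
  qed
  finally show ?thesis by (simp add: exp_add[symmetric] mult.assoc)
qed

lemma integrable_gaussian:
  assumes "0 < w"
  shows "integrable lborel (\<lambda>y::real. exp (- y\<^sup>2 / (8 * w)))"
proof -
  \<comment> \<open>The exponent -y^2 / (8 w) belongs to variance 4 w, that is to standard deviation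
    2 sqrt w.\<close>
  have "integrable lborel (\<lambda>y. sqrt (2 * pi * (2 * sqrt w)\<^sup>2) * normal_density 0 (2 * sqrt w) y)"
    using assms by (intro integrable_mult_right) auto
  thus ?thesis using assms by (simp add: normal_density_def power_mult_distrib)
qed

locale bounded_terminal =
  fixes F :: "real \<Rightarrow> complex"
  assumes F_meas [measurable]: "F \<in> borel_measurable borel"
    and F_le1: "norm (F y) \<le> 1"
begin

lemma norm_gauss_ker_scaleR_le:
  assumes "0 < v" "v \<le> w" "\<bar>m\<bar> \<le> R"
  shows "norm (gauss_ker k v m y *\<^sub>R F y) \<le> fact k * exp (2 * w + R\<^sup>2 / (4 * w)) * exp (- y\<^sup>2 / (8 * w))"
proof -
  have "norm (gauss_ker k v m y *\<^sub>R F y) \<le> \<bar>gauss_ker k v m y\<bar> * 1"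
    unfolding norm_scaleR real_norm_def by (intro mult_left_mono F_le1) auto
  also have "\<dots> \<le> fact k * exp (2 * w + R\<^sup>2 / (4 * w)) * exp (- y\<^sup>2 / (8 * w))"
    using gauss_ker_bound[OF assms] by simp
  finally show ?thesis .
qed

lemma integrable_gauss_ker:
  assumes "0 < v"
  shows "integrable lborel (\<lambda>y. gauss_ker k v m y *\<^sub>R F y)"
proof (rule Bochner_Integration.integrable_bound)
  show "integrable lborel (\<lambda>y. fact k * exp (2 * v + \<bar>m\<bar>\<^sup>2 / (4 * v)) * exp (- y\<^sup>2 / (8 * v)))"
    by (intro integrable_mult_right integrable_gaussian assms)
  show "AE y in lborel. norm (gauss_ker k v m y *\<^sub>R F y)
      \<le> norm (fact k * exp (2 * v + \<bar>m\<bar>\<^sup>2 / (4 * v)) * exp (- y\<^sup>2 / (8 * v)))"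
    using norm_gauss_ker_scaleR_le[OF assms order_refl order_refl]
    by (intro AE_I2) (simp add: abs_mult)
qed measurable

text \<open>Along a convergent sequence of parameters the variances and means stay bounded, so one
  majorant from \<open>gauss_ker_bound\<close> serves the whole sequence.\<close>

lemma continuous_on_gauss_moment:
  "continuous_on ({0<..} \<times> UNIV) (\<lambda>(v, m). gauss_moment F k v m)"
proof (rule continuous_on_sequentiallyI)
  fix u :: "nat \<Rightarrow> real \<times> real" and p
  assume u: "\<forall>n. u n \<in> {0<..} \<times> UNIV" and p: "p \<in> {0<..} \<times> (UNIV :: real set)" and lim: "u \<longlonglongrightarrow> p"
  have lim1: "(\<lambda>n. fst (u n)) \<longlonglongrightarrow> fst p" and lim2: "(\<lambda>n. snd (u n)) \<longlonglongrightarrow> snd p"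
    using lim by (auto intro: tendsto_fst tendsto_snd)
  have pos: "0 < fst (u n)" "0 < fst p" for n using u p by (auto simp: mem_Times_iff)
  obtain w where w: "\<And>n. \<bar>fst (u n)\<bar> \<le> w"
    using convergent_imp_Bseq[OF convergentI[OF lim1]] by (auto simp: Bseq_def)
  obtain R where R: "\<And>n. \<bar>snd (u n)\<bar> \<le> R"
    using convergent_imp_Bseq[OF convergentI[OF lim2]] by (auto simp: Bseq_def)
  have w': "fst (u n) \<le> w" for n using w[of n] by simp
  have w0: "0 < w" using pos(1)[of 0] w'[of 0] by simp
  have "(\<lambda>n. gauss_moment F k (fst (u n)) (snd (u n))) \<longlonglongrightarrow> gauss_moment F k (fst p) (snd p)"
    unfolding gauss_moment_def
  proof (rule integral_dominated_convergence
      [where w = "\<lambda>y. fact k * exp (2 * w + R\<^sup>2 / (4 * w)) * exp (- y\<^sup>2 / (8 * w))"])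
    show "integrable lborel (\<lambda>y. fact k * exp (2 * w + R\<^sup>2 / (4 * w)) * exp (- y\<^sup>2 / (8 * w)))"
      by (intro integrable_mult_right integrable_gaussian w0)
    show "AE y in lborel. (\<lambda>n. gauss_ker k (fst (u n)) (snd (u n)) y *\<^sub>R F y) \<longlonglongrightarrow> gauss_ker k (fst p) (snd p) y *\<^sub>R F y"
      unfolding gauss_ker_def using pos by (intro AE_I2 tendsto_intros lim1 lim2) auto
    show "AE y in lborel. norm (gauss_ker k (fst (u n)) (snd (u n)) y *\<^sub>R F y)
       \<le> fact k * exp (2 * w + R\<^sup>2 / (4 * w)) * exp (- y\<^sup>2 / (8 * w))" for n
      by (intro AE_I2 norm_gauss_ker_scaleR_le pos w' R)
  qed measurable
  thus "(\<lambda>n. case u n of (v, m) \<Rightarrow> gauss_moment F k v m) \<longlonglongrightarrow> (case p of (v, m) \<Rightarrow> gauss_moment F k v m)"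
    by (simp add: case_prod_unfold)
qed

text \<open>At \<open>k = 0\<close> the first summand vanishes, so the truncated \<open>k - 1\<close> is harmless.\<close>
lemma gauss_moment_has_vector_derivative:
  assumes x: "x \<in> {l<..<u}"
    and dm: "\<And>t. t \<in> {l<..<u} \<Longrightarrow> (m has_real_derivative m' t) (at t)"
    and dv: "\<And>t. t \<in> {l<..<u} \<Longrightarrow> (v has_real_derivative v' t) (at t)"
    and cm: "continuous_on {l<..<u} m'" and cv: "continuous_on {l<..<u} v'"
    and pos: "\<And>t. t \<in> {l<..<u} \<Longrightarrow> 0 < v t"
  shows "((\<lambda>t. gauss_moment F k (v t) (m t)) has_vector_derivative
      (- real k * m' x) *\<^sub>R gauss_moment F (k - 1) (v x) (m x)
      + (m' x / v x) *\<^sub>R gauss_moment F (k + 1) (v x) (m x)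
      + (v' x / (2 * (v x)\<^sup>2)) *\<^sub>R gauss_moment F (k + 2) (v x) (m x)) (at x)"
proof -
  define g where "g = (\<lambda>t y. gauss_ker k (v t) (m t) y *\<^sub>R F y)"
  \<comment> \<open>The summands come from differentiating the power, the exponent through
    \<open>m\<close>, and the exponent through \<open>v\<close>, in this order.\<close>
  define g' where "g' = (\<lambda>t y. (- real k * m' t) *\<^sub>R (gauss_ker (k - 1) (v t) (m t) y *\<^sub>R F y)
      + (m' t / v t) *\<^sub>R (gauss_ker (k + 1) (v t) (m t) y *\<^sub>R F y)
      + (v' t / (2 * (v t)\<^sup>2)) *\<^sub>R (gauss_ker (k + 2) (v t) (m t) y *\<^sub>R F y))"
  \<comment> \<open>Passing to a compact subinterval makes the continuous coefficients bounded, as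
    the majorant requires.\<close>
  obtain l' u' where lu: "l < l'" "l' < x" "x < u'" "u' < u"
    using x by (metis dense greaterThanLessThan_iff)
  have sub: "{l'..u'} \<subseteq> {l<..<u}" using lu by auto
  have bdd: "\<exists>C. \<forall>t\<in>{l'..u'}. \<bar>h t\<bar> \<le> C" if "continuous_on {l<..<u} h" for h :: "real \<Rightarrow> real"
    using compact_continuous_image[OF continuous_on_subset[OF that sub] compact_Icc, THEN compact_imp_bounded]
    by (auto simp: bounded_iff)
  have cm0: "continuous_on {l<..<u} m" and cv0: "continuous_on {l<..<u} v"
    using dm dv by (meson continuous_at_imp_continuous_on DERIV_isCont)+
  obtain R where R: "\<And>t. t \<in> {l'..u'} \<Longrightarrow> \<bar>m t\<bar> \<le> R" using bdd[OF cm0] by blast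
  obtain w where w: "\<And>t. t \<in> {l'..u'} \<Longrightarrow> \<bar>v t\<bar> \<le> w" using bdd[OF cv0] by blast
  obtain C1 where C1: "\<And>t. t \<in> {l'..u'} \<Longrightarrow> \<bar>- real k * m' t\<bar> \<le> C1"
    using bdd[of "\<lambda>t. - real k * m' t"] cm by (force intro: continuous_intros)
  obtain C2 where C2: "\<And>t. t \<in> {l'..u'} \<Longrightarrow> \<bar>m' t / v t\<bar> \<le> C2"
    using bdd[of "\<lambda>t. m' t / v t"] cm cv0 pos by (force intro!: continuous_intros)
  obtain C3 where C3: "\<And>t. t \<in> {l'..u'} \<Longrightarrow> \<bar>v' t / (2 * (v t)\<^sup>2)\<bar> \<le> C3"
    using bdd[of "\<lambda>t. v' t / (2 * (v t)\<^sup>2)"] cv cv0 pos by (force intro!: continuous_intros)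
  have w': "v t \<le> w" if "t \<in> {l'..u'}" for t using w[OF that] by simp
  have pos': "0 < v t" if "t \<in> {l'..u'}" for t using pos that sub by auto
  have x': "x \<in> {l'..u'}" using lu by auto
  have w0: "0 < w" using pos'[OF x'] w'[OF x'] by simp
  define bd where "bd = (\<lambda>k y. fact k * exp (2 * w + R\<^sup>2 / (4 * w)) * exp (- y\<^sup>2 / (8 * w)) :: real)"
  have bd_int: "integrable lborel (bd k)" for k
    unfolding bd_def by (intro integrable_mult_right integrable_gaussian w0)
  have bd: "norm (gauss_ker k (v t) (m t) y *\<^sub>R F y) \<le> bd k y" if "t \<in> {l'..u'}" for k t y
    unfolding bd_def using that by (intro norm_gauss_ker_scaleR_le pos' w' R) auto
  have "((\<lambda>t. integral\<^sup>L lborel (g t)) has_vector_derivative integral\<^sup>L lborel (g' x)) (at x)"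
  proof (rule has_vector_derivative_lebesgue_integral
      [where l = l' and u = u' and B = "\<lambda>y. C1 * bd (k - 1) y + C2 * bd (k + 1) y + C3 * bd (k + 2) y"])
    show "x \<in> {l'<..<u'}" using lu by simp
    show "integrable lborel (g t)" if "t \<in> {l'<..<u'}" for t
      unfolding g_def using that by (intro integrable_gauss_ker pos') auto
    show "g' x \<in> borel_measurable lborel" unfolding g'_def by measurable
    show "integrable lborel (\<lambda>y. C1 * bd (k - 1) y + C2 * bd (k + 1) y + C3 * bd (k + 2) y)"
      by (intro Bochner_Integration.integrable_add integrable_mult_right bd_int)
    fix t y assume t: "t \<in> {l'<..<u'}"
    hence t': "t \<in> {l'..u'}" by simp
    show "norm (g' t y) \<le> C1 * bd (k - 1) y + C2 * bd (k + 1) y + C3 * bd (k + 2) y"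
    proof -
      have nn: "norm (c *\<^sub>R (gauss_ker i (v t) (m t) y *\<^sub>R F y)) \<le> C * bd i y" if "\<bar>c\<bar> \<le> C" for c C i
        unfolding norm_scaleR[of c] using bd[OF t', of i y] that by (intro mult_mono) auto
      show ?thesis unfolding g'_def
        by (intro norm_triangle_mono nn C1[OF t'] C2[OF t'] C3[OF t'])
    qed
    have v0: "v t \<noteq> 0" using pos'[OF t'] by simp
    have "t \<in> {l<..<u}" using t' sub by auto
    note d = dm[OF this] dv[OF this]
    have "((\<lambda>t. gauss_ker k (v t) (m t) y) has_real_derivative
        (- real k * m' t) * gauss_ker (k - 1) (v t) (m t) y + (m' t / v t) * gauss_ker (k + 1) (v t) (m t) y
      + (v' t / (2 * (v t)\<^sup>2)) * gauss_ker (k + 2) (v t) (m t) y) (at t)"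
    proof -
      define z where "z = y - m t"
      have "((\<lambda>t. (y - m t) ^ k) has_real_derivative - real k * m' t * z ^ (k - 1)) (at t)"
        unfolding z_def using d(1) by (auto intro!: derivative_eq_intros)
      moreover have "((\<lambda>t. exp (- (y - m t)\<^sup>2 / (2 * v t))) has_real_derivative
          exp (- z\<^sup>2 / (2 * v t)) * (z * m' t / v t + z\<^sup>2 * v' t / (2 * (v t)\<^sup>2))) (at t)"
        unfolding z_def using d v0
        by (auto intro!: derivative_eq_intros simp: power2_eq_square field_simps)
      ultimately have "((\<lambda>t. (y - m t) ^ k * exp (- (y - m t)\<^sup>2 / (2 * v t))) has_real_derivative
          - real k * m' t * z ^ (k - 1) * exp (- z\<^sup>2 / (2 * v t))
          + exp (- z\<^sup>2 / (2 * v t)) * (z * m' t / v t + z\<^sup>2 * v' t / (2 * (v t)\<^sup>2)) * z ^ k) (at t)"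
        unfolding z_def by (rule DERIV_mult)
      thus ?thesis unfolding gauss_ker_def z_def[symmetric]
        by (simp add: algebra_simps power2_eq_square)
    qed
    hence "((\<lambda>t. gauss_ker k (v t) (m t) y *\<^sub>R F y) has_vector_derivative
        ((- real k * m' t) * gauss_ker (k - 1) (v t) (m t) y + (m' t / v t) * gauss_ker (k + 1) (v t) (m t) y
      + (v' t / (2 * (v t)\<^sup>2)) * gauss_ker (k + 2) (v t) (m t) y) *\<^sub>R F y) (at t)"
      using has_vector_derivative_scaleR[OF _ has_vector_derivative_const] by fastforce
    thus "((\<lambda>t. g t y) has_vector_derivative g' t y) (at t)"
      unfolding g_def g'_def by (simp only: scaleR_add_left scaleR_scaleR)
  qed
  moreover have "integral\<^sup>L lborel (g' x) = (- real k * m' x) *\<^sub>R gauss_moment F (k - 1) (v x) (m x)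
      + (m' x / v x) *\<^sub>R gauss_moment F (k + 1) (v x) (m x)
      + (v' x / (2 * (v x)\<^sup>2)) *\<^sub>R gauss_moment F (k + 2) (v x) (m x)"
    unfolding g'_def gauss_moment_def
    using integrable_gauss_ker[OF pos'[OF x']]
    by (simp del: scaleR_scaleR add: Bochner_Integration.integral_add Bochner_Integration.integrable_add)
  ultimately show ?thesis unfolding g_def gauss_moment_def by simp
qed

end

section \<open>Law of the process\<close>

text \<open>Expectation of F (m + \<sigma> Z) for a standard normal Z. Taking \<sigma> rather than
  the variance as parameter includes the degenerate law at \<sigma> = 0.\<close>

definition gauss_avg :: "(real \<Rightarrow> complex) \<Rightarrow> real \<Rightarrow> real \<Rightarrow> complex" where
  "gauss_avg F m \<sigma> = (\<integral>z. std_normal_density z *\<^sub>R F (m + \<sigma> * z) \<partial>lborel)"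

lemma gauss_avg_0 [simp]: "gauss_avg F m 0 = F m"
  by (simp add: gauss_avg_def)

lemma continuous_gauss_avg:
  assumes cont: "continuous_on UNIV F" and le1: "\<And>y. norm (F y) \<le> 1"
  shows "continuous_on UNIV (\<lambda>(m, \<sigma>). gauss_avg F m \<sigma>)"
proof (rule continuous_on_sequentiallyI)
  fix u :: "nat \<Rightarrow> real \<times> real" and p assume lim: "u \<longlonglongrightarrow> p"
  have [measurable]: "F \<in> borel_measurable borel" by (rule borel_measurable_continuous_onI[OF cont])
  have "(\<lambda>n. gauss_avg F (fst (u n)) (snd (u n))) \<longlonglongrightarrow> gauss_avg F (fst p) (snd p)"
    unfolding gauss_avg_def
  proof (rule integral_dominated_convergence[where w = std_normal_density])
    show "AE z in lborel. (\<lambda>n. std_normal_density z *\<^sub>R F (fst (u n) + snd (u n) * z))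
        \<longlonglongrightarrow> std_normal_density z *\<^sub>R F (fst p + snd p * z)"
      by (intro AE_I2 tendsto_intros continuous_on_tendsto_compose[OF cont] lim) auto
    show "AE z in lborel. norm (std_normal_density z *\<^sub>R F (fst (u n) + snd (u n) * z)) \<le> std_normal_density z" for n
      using le1 by (intro AE_I2) (simp add: mult_left_le)
  qed (auto intro!: borel_measurable_scaleR)
  thus "(\<lambda>n. case u n of (m, \<sigma>) \<Rightarrow> gauss_avg F m \<sigma>) \<longlonglongrightarrow> (case p of (m, \<sigma>) \<Rightarrow> gauss_avg F m \<sigma>)"
    by (simp add: case_prod_unfold)
qed

text \<open>The substitution y = m + sqrt v z moves the parameters out of the merely continuous
  \<open>F\<close> into the smooth kernel.\<close>

lemma gauss_avg_eq_gauss_moment: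
  assumes v: "0 < v" and [measurable]: "F \<in> borel_measurable borel"
  shows "gauss_avg F m (sqrt v) = (1 / sqrt (2 * pi * v)) *\<^sub>R gauss_moment F 0 v m"
proof -
  have "gauss_moment F 0 v m = \<bar>sqrt v\<bar> *\<^sub>R (\<integral>z. gauss_ker 0 v m (m + sqrt v * z) *\<^sub>R F (m + sqrt v * z) \<partial>lborel)"
    unfolding gauss_moment_def using v by (intro lborel_integral_real_affine) auto
  also have "(\<lambda>z. gauss_ker 0 v m (m + sqrt v * z) *\<^sub>R F (m + sqrt v * z))
      = (\<lambda>z. sqrt (2 * pi) *\<^sub>R (std_normal_density z *\<^sub>R F (m + sqrt v * z)))"
    using v by (simp add: gauss_ker_def std_normal_density_def power_mult_distrib)
  also have "(\<integral>z. sqrt (2 * pi) *\<^sub>R (std_normal_density z *\<^sub>R F (m + sqrt v * z)) \<partial>lborel)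
      = sqrt (2 * pi) *\<^sub>R gauss_avg F m (sqrt v)"
    unfolding gauss_avg_def by (rule integral_scaleR_right)
  finally show ?thesis using v by (simp add: real_sqrt_mult)
qed

section \<open>Bounded expectations and independence\<close>

lemma (in prob_space) norm_integral_le_1:
  fixes g :: "'a \<Rightarrow> complex"
  assumes "\<And>\<omega>. norm (g \<omega>) \<le> 1"
  shows "norm (integral\<^sup>L M g) \<le> 1"
proof (cases "integrable M g")
  case True
  have "norm (integral\<^sup>L M g) \<le> (\<integral>\<omega>. norm (g \<omega>) \<partial>M)" by (rule integral_norm_bound)
  also have "\<dots> \<le> (\<integral>\<omega>. 1 \<partial>M)"
    using True assms by (intro integral_mono integrable_norm) auto
  also have "\<dots> = 1" by (simp add: prob_space)
  finally show ?thesis .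
\<comment> \<open>The Bochner integral of a non-integrable function is 0 by convention.\<close>
qed (simp add: not_integrable_integral_eq)

text \<open>Independence makes the joint law a product, and Fubini freezes the first component. This
  stands in for conditioning on the past.\<close>

lemma (in prob_space) indep_var_integral_pair:
  fixes \<Psi> :: "'b \<times> 'b \<Rightarrow> complex"
  assumes ind: "indep_var S A R B" and \<Psi> [measurable]: "\<Psi> \<in> borel_measurable (S \<Otimes>\<^sub>M R)"
    and le1: "\<And>p. norm (\<Psi> p) \<le> 1"
  shows "(\<integral>\<omega>. \<Psi> (A \<omega>, B \<omega>) \<partial>M) = (\<integral>\<omega>. (\<integral>\<omega>'. \<Psi> (A \<omega>, B \<omega>') \<partial>M) \<partial>M)"
proof -
  have A [measurable]: "A \<in> measurable M S" and B [measurable]: "B \<in> measurable M R"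
    and eq: "distr M S A \<Otimes>\<^sub>M distr M R B = distr M (S \<Otimes>\<^sub>M R) (\<lambda>\<omega>. (A \<omega>, B \<omega>))"
    using ind by (auto simp: indep_var_distribution_eq)
  interpret SA: prob_space "distr M S A" by (rule prob_space_distr) measurable
  interpret RB: prob_space "distr M R B" by (rule prob_space_distr) measurable
  interpret P: pair_prob_space "distr M S A" "distr M R B" ..
  have "integrable (distr M S A \<Otimes>\<^sub>M distr M R B) \<Psi>"
    by (rule P.integrable_const_bound[where B = 1]) (use le1 in auto)
  hence "integral\<^sup>L (distr M S A \<Otimes>\<^sub>M distr M R B) \<Psi>
      = (\<integral>x. (\<integral>y. \<Psi> (x, y) \<partial>distr M R B) \<partial>distr M S A)"
    by (rule P.integral_fst'[symmetric])
  also have "\<dots> = (\<integral>x. (\<integral>\<omega>'. \<Psi> (x, B \<omega>') \<partial>M) \<partial>distr M S A)"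
    by (intro Bochner_Integration.integral_cong refl integral_distr) auto
  also have "\<dots> = (\<integral>\<omega>. (\<integral>\<omega>'. \<Psi> (A \<omega>, B \<omega>') \<partial>M) \<partial>M)"
    by (rule integral_distr) measurable
  finally show ?thesis
    unfolding eq by (subst (asm) integral_distr) auto
qed

lemma ou_sum_degenerate [simp]: "ou_sum b c w r r N = 0"
  by (simp add: ou_sum_def grid_def)

section \<open>The linear equation driven by Brownian motion\<close>

locale ou_process = prob_space M for M :: "'a measure" +
  fixes W :: "real \<Rightarrow> 'a \<Rightarrow> real" and X :: "real \<Rightarrow> real \<Rightarrow> real \<Rightarrow> 'a \<Rightarrow> real"
    and a b c T :: real
  assumes BM: "brownian_motion M W" and c_ne: "c \<noteq> 0"
    and X_meas: "\<And>t x s. t \<in> {0..T} \<Longrightarrow> s \<in> {t..T} \<Longrightarrow> X t x s \<in> borel_measurable M"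
    and X_sol: "\<And>t x. t \<in> {0..T} \<Longrightarrow>
        AE \<omega> in M. continuous_on {t..T} (\<lambda>s. X t x s \<omega>)
          \<and> (\<forall>s\<in>{t..T}. X t x s \<omega> =
               x + integral {t..s} (\<lambda>r. a + b * X t x r \<omega>) + c * (W s \<omega> - W t \<omega>))"
begin

lemma W_meas: "0 \<le> t \<Longrightarrow> W t \<in> borel_measurable M"
  using BM by (simp add: brownian_motion_def)

lemma ou_sum_meas:
  assumes "0 \<le> r" "r \<le> s"
  shows "(\<lambda>\<omega>. ou_sum b c (\<lambda>u. W u \<omega>) r s N) \<in> borel_measurable M"
proof -
  have "0 \<le> grid r s N k" for k
    using grid_mono[of r s 0 k N] assms by simp
  thus ?thesis unfolding ou_sum_def
    by (intro borel_measurable_sum borel_measurable_times borel_measurable_diff W_meas) auto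
qed

lemma X_start:
  assumes "t \<in> {0..T}"
  shows "AE \<omega> in M. X t x t \<omega> = x"
  using X_sol[OF assms, of x] by eventually_elim (use assms in auto)

text \<open>Additivity of the integral restarts the equation at \<open>r\<close>; for each good path
  \<open>ou_sum_tendsto\<close> then applies with initial value
  \<open>X t x r \<omega>\<close>.\<close>

lemma X_limit:
  assumes t: "0 \<le> t" "t \<le> r" "r \<le> s" "s \<le> T"
  shows "AE \<omega> in M. (\<lambda>N. ou_sum b c (\<lambda>u. W u \<omega>) r s N)
      \<longlonglongrightarrow> X t x s \<omega> - exp (b * (s - r)) * X t x r \<omega> - a * expm1_quot b (s - r)"
proof -
  have "t \<in> {0..T}" using t by simp
  from X_sol[OF this, of x] show ?thesis
  proof eventually_elim
    case (elim \<omega>)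
    hence cont: "continuous_on {t..T} (\<lambda>s. X t x s \<omega>)" and
      sol: "\<And>u. u \<in> {t..T} \<Longrightarrow> X t x u \<omega> = x + integral {t..u} (\<lambda>r. a + b * X t x r \<omega>) + c * (W u \<omega> - W t \<omega>)"
      by auto
    show ?case
    proof (rule ou_sum_tendsto[OF t(3)])
      show "continuous_on {r..s} (\<lambda>s. X t x s \<omega>)"
        by (rule continuous_on_subset[OF cont]) (use t in auto)
      fix u assume u: "u \<in> {r..s}"
      have "(\<lambda>v. a + b * X t x v \<omega>) integrable_on {t..u}"
        by (intro integrable_continuous_real continuous_intros continuous_on_subset[OF cont]) (use t u in auto)
      hence "integral {t..u} (\<lambda>v. a + b * X t x v \<omega>)
          = integral {t..r} (\<lambda>v. a + b * X t x v \<omega>) + integral {r..u} (\<lambda>v. a + b * X t x v \<omega>)"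
        using Henstock_Kurzweil_Integration.integral_combine[of t r u "\<lambda>v. a + b * X t x v \<omega>"] t u by simp
      thus "X t x u \<omega> = X t x r \<omega> + integral {r..u} (\<lambda>v. a + b * X t x v \<omega>) + c * (W u \<omega> - W r \<omega>)"
        using sol[of u] sol[of r] t u by (simp add: algebra_simps)
    qed
  qed
qed

lemma X_flow:
  assumes t: "0 \<le> t" "t \<le> r" "r \<le> s" "s \<le> T"
  shows "AE \<omega> in M. X t x s \<omega> = exp (b * (s - r)) * X t x r \<omega> + X r 0 s \<omega>"
proof -
  have r: "0 \<le> r" "r \<in> {0..T}" using t by auto
  from X_limit[OF t, of x] X_limit[OF r(1) order_refl t(3,4), of 0] X_start[OF r(2), of 0]
  show ?thesis
  proof eventually_elim
    case (elim \<omega>)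
    from LIMSEQ_unique[OF elim(1,2)] elim(3) show ?case by simp
  qed
qed

lemma increments_indep:
  assumes "0 \<le> ts 0" "\<And>i. i < k \<Longrightarrow> ts i \<le> ts (Suc i)"
  shows "indep_vars (\<lambda>_. borel) (\<lambda>i \<omega>. W (ts (Suc i)) \<omega> - W (ts i) \<omega>) {..<k}"
  using BM assms unfolding brownian_motion_def by blast

text \<open>A linear combination of independent centred normals. \<open>r < s\<close>,
  \<open>0 < N\<close> and \<open>c \<noteq> 0\<close> make every summand nondegenerate, so that
  each has a density.\<close>

lemma ou_sum_distributed:
  assumes rs: "0 \<le> r" "r < s" and N: "0 < N"
  shows "distributed M lborel (\<lambda>\<omega>. ou_sum b c (\<lambda>u. W u \<omega>) r s N)
      (normal_density 0 (sqrt (c\<^sup>2 * ou_sum (2 * b) 1 (\<lambda>u. u) r s N)))"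
proof -
  let ?g = "grid r s N"
  define \<alpha> where "\<alpha> = (\<lambda>k. c * exp (b * (s - ?g k)))"
  have g0: "0 \<le> ?g k" for k using grid_mono[of r s 0 k N] rs by simp
  have lt: "?g k < ?g (Suc k)" for k
    using divide_pos_pos[of "s - r" "real N"] rs N unfolding grid_Suc_diff[of r s N k, symmetric] by simp
  have "indep_vars (\<lambda>_. borel) (\<lambda>i \<omega>. W (?g (Suc i)) \<omega> - W (?g i) \<omega>) {..<N}"
    using lt rs by (intro increments_indep) (auto intro: less_imp_le)
  hence ind: "indep_vars (\<lambda>_. borel) (\<lambda>i \<omega>. \<alpha> i * (W (?g (Suc i)) \<omega> - W (?g i) \<omega>)) {..<N}"
    by (rule indep_vars_compose2) auto
  have dist: "distributed M lborel (\<lambda>\<omega>. \<alpha> i * (W (?g (Suc i)) \<omega> - W (?g i) \<omega>))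
      (normal_density 0 (\<bar>\<alpha> i\<bar> * sqrt (?g (Suc i) - ?g i)))" for i
  proof -
    have "distributed M lborel (\<lambda>\<omega>. W (?g (Suc i)) \<omega> - W (?g i) \<omega>) (normal_density 0 (sqrt (?g (Suc i) - ?g i)))"
      using BM g0 lt unfolding brownian_motion_def by blast
    from normal_density_affine[OF this, of "\<alpha> i" 0] show ?thesis
      using lt c_ne by (simp add: \<alpha>_def)
  qed
  have "distributed M lborel (\<lambda>\<omega>. \<Sum>i<N. \<alpha> i * (W (?g (Suc i)) \<omega> - W (?g i) \<omega>))
     (normal_density (\<Sum>i<N. 0) (sqrt (\<Sum>i<N. (\<bar>\<alpha> i\<bar> * sqrt (?g (Suc i) - ?g i))\<^sup>2)))"
    using N lt c_ne by (intro sum_indep_normal ind dist) (auto simp: \<alpha>_def)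
  \<comment> \<open>Squaring the weights doubles the rate \<open>b\<close>, so the variance is again
    an \<open>ou_sum\<close>, driven by the identity.\<close>
  moreover have "(\<Sum>i<N. (\<bar>\<alpha> i\<bar> * sqrt (?g (Suc i) - ?g i))\<^sup>2) = c\<^sup>2 * ou_sum (2 * b) 1 (\<lambda>u. u) r s N"
    unfolding ou_sum_def sum_distrib_left
  proof (intro sum.cong refl)
    fix i
    have "(exp (b * (s - ?g i)))\<^sup>2 = exp (2 * b * (s - ?g i))"
      by (simp add: power2_eq_square exp_add[symmetric] algebra_simps)
    thus "(\<bar>\<alpha> i\<bar> * sqrt (?g (Suc i) - ?g i))\<^sup>2 = c\<^sup>2 * (1 * exp (2 * b * (s - ?g i)) * (?g (Suc i) - ?g i))"
      using lt[of i] by (simp add: \<alpha>_def power_mult_distrib)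
  qed
  ultimately show ?thesis by (simp add: ou_sum_def \<alpha>_def)
qed

lemma ou_sum_expectation:
  assumes rs: "0 \<le> r" "r < s" and N: "0 < N" and [measurable]: "F \<in> borel_measurable borel"
  shows "(\<integral>\<omega>. F (m + ou_sum b c (\<lambda>u. W u \<omega>) r s N) \<partial>M)
      = gauss_avg F m (sqrt (c\<^sup>2 * ou_sum (2 * b) 1 (\<lambda>u. u) r s N))"
proof -
  define \<sigma> where "\<sigma> = sqrt (c\<^sup>2 * ou_sum (2 * b) 1 (\<lambda>u. u) r s N)"
  have "0 < ou_sum (2 * b) 1 (\<lambda>u. u) r s N"
    unfolding ou_sum_def grid_Suc_diff using rs N by (intro sum_pos) auto
  hence \<sigma>: "0 < \<sigma>" using c_ne by (simp add: \<sigma>_def)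
  \<comment> \<open>The \<open>- 0\<close> keeps the shape (value - mean) / deviation expected by
    the standardisation rule.\<close>
  define Z where "Z = (\<lambda>\<omega>. (ou_sum b c (\<lambda>u. W u \<omega>) r s N - 0) / \<sigma>)"
  have Z: "distributed M lborel Z std_normal_density"
    using ou_sum_distributed[OF rs N] unfolding Z_def \<sigma>_def[symmetric]
    by (subst normal_standard_normal_convert[OF \<sigma>, symmetric])
  have [measurable]: "Z \<in> borel_measurable M"
    using distributed_measurable[OF Z] by simp
  have "(\<integral>\<omega>. F (m + \<sigma> * Z \<omega>) \<partial>M) = (\<integral>z. F (m + \<sigma> * z) \<partial>distr M lborel Z)"
    by (rule integral_distr[symmetric]) auto
  also have "distr M lborel Z = density lborel std_normal_density"
    by (rule distributed_distr_eq_density[OF Z])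
  also have "(\<integral>z. F (m + \<sigma> * z) \<partial>density lborel std_normal_density) = gauss_avg F m \<sigma>"
    unfolding gauss_avg_def by (rule integral_density) auto
  finally show ?thesis using \<sigma> by (simp add: Z_def \<sigma>_def[symmetric])
qed

text \<open>The expectations along the sums converge to both sides: pathwise by dominated
  convergence, and in law because \<open>gauss_avg\<close> is continuous in \<sigma>. The case
  \<open>t = r\<close> is separate since a deviation of 0 has no density.\<close>

lemma expectation_X:
  assumes tr: "0 \<le> t" "t \<le> r" "r \<le> T"
    and cont: "continuous_on UNIV F" and le1: "\<And>y. norm (F y) \<le> 1"
  shows "(\<integral>\<omega>. F (X t x r \<omega>) \<partial>M) = gauss_avg F (exp (b * (r - t)) * x + a * expm1_quot b (r - t))
      (sqrt (c\<^sup>2 * expm1_quot (2 * b) (r - t)))"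
proof (cases "t = r")
  case True
  have "r \<in> {0..T}" using tr by simp
  from X_start[OF this, of x] have "AE \<omega> in M. F (X r x r \<omega>) = F x" by eventually_elim simp
  moreover have [measurable]: "F \<in> borel_measurable borel" "X r x r \<in> borel_measurable M"
    using tr by (auto intro!: borel_measurable_continuous_onI[OF cont] X_meas)
  ultimately have "(\<integral>\<omega>. F (X r x r \<omega>) \<partial>M) = (\<integral>\<omega>. F x \<partial>M)"
    by (intro integral_cong_AE) auto
  thus ?thesis using True by (simp add: prob_space)
next
  case False
  hence tr': "t < r" using tr by simp
  define m where "m = exp (b * (r - t)) * x + a * expm1_quot b (r - t)"
  have F [measurable]: "F \<in> borel_measurable borel" by (rule borel_measurable_continuous_onI[OF cont])
  have [measurable]: "X t x r \<in> borel_measurable M" using tr by (intro X_meas) auto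
  have [measurable]: "(\<lambda>\<omega>. ou_sum b c (\<lambda>u. W u \<omega>) t r N) \<in> borel_measurable M" for N
    using tr by (intro ou_sum_meas) auto
  have "t \<in> {0..T}" using tr by simp
  note ae = X_limit[OF tr(1) order_refl tr(2,3), of x] X_start[OF this, of x]
  have L: "(\<lambda>N. \<integral>\<omega>. F (m + ou_sum b c (\<lambda>u. W u \<omega>) t r N) \<partial>M) \<longlonglongrightarrow> (\<integral>\<omega>. F (X t x r \<omega>) \<partial>M)"
  proof (rule integral_dominated_convergence[where w = "\<lambda>_. 1"])
    from ae show "AE \<omega> in M. (\<lambda>N. F (m + ou_sum b c (\<lambda>u. W u \<omega>) t r N)) \<longlonglongrightarrow> F (X t x r \<omega>)"
    proof eventually_elim
      case (elim \<omega>)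
      have "(\<lambda>N. m + ou_sum b c (\<lambda>u. W u \<omega>) t r N) \<longlonglongrightarrow> X t x r \<omega>"
        using tendsto_add[OF tendsto_const[of m] elim(1)] elim(2) by (simp add: m_def)
      thus ?case by (intro continuous_on_tendsto_compose[OF cont]) auto
    qed
  qed (use le1 in auto)
  have "(\<lambda>N. gauss_avg F m (sqrt (c\<^sup>2 * ou_sum (2 * b) 1 (\<lambda>u. u) t r N)))
      \<longlonglongrightarrow> gauss_avg F m (sqrt (c\<^sup>2 * expm1_quot (2 * b) (r - t)))"
  proof -
    have "(\<lambda>N. (m, sqrt (c\<^sup>2 * ou_sum (2 * b) 1 (\<lambda>u. u) t r N))) \<longlonglongrightarrow> (m, sqrt (c\<^sup>2 * expm1_quot (2 * b) (r - t)))"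
      by (intro tendsto_intros ou_sum_id_tendsto tr)
    from continuous_on_tendsto_compose[OF continuous_gauss_avg[OF cont le1] this] show ?thesis by simp
  qed
  moreover have "\<forall>\<^sub>F N in sequentially. gauss_avg F m (sqrt (c\<^sup>2 * ou_sum (2 * b) 1 (\<lambda>u. u) t r N))
      = (\<integral>\<omega>. F (m + ou_sum b c (\<lambda>u. W u \<omega>) t r N) \<partial>M)"
    using eventually_gt_at_top[of 0]
    by eventually_elim (use ou_sum_expectation[OF tr(1) tr' _ F] in auto)
  ultimately have "(\<lambda>N. \<integral>\<omega>. F (m + ou_sum b c (\<lambda>u. W u \<omega>) t r N) \<partial>M)
      \<longlonglongrightarrow> gauss_avg F m (sqrt (c\<^sup>2 * expm1_quot (2 * b) (r - t)))"
    by (rule Lim_transform_eventually)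
  from LIMSEQ_unique[OF L this] show ?thesis by (simp add: m_def)
qed

end

section \<open>Markov property\<close>

context ou_process
begin

text \<open>The exponential of a sum over grid times is a product of factors at r, r + \<delta>,
  ..., r + m \<delta>. The start (t, x) may precede \<open>r\<close>.\<close>

definition markov_avg :: "(nat \<Rightarrow> real \<Rightarrow> complex) \<Rightarrow> real \<Rightarrow> real \<Rightarrow> nat \<Rightarrow> real \<Rightarrow> real \<Rightarrow> complex" where
  "markov_avg \<phi> r \<delta> m t x = (\<integral>\<omega>. (\<Prod>i\<le>m. \<phi> i (X t x (r + real i * \<delta>) \<omega>)) \<partial>M)"

context
  fixes \<phi> :: "nat \<Rightarrow> real \<Rightarrow> complex" and r \<delta> :: real and m :: nat
  assumes r0: "0 \<le> r" and \<delta>0: "0 \<le> \<delta>" and rT: "r + real m * \<delta> \<le> T"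
    and \<phi>_cont: "\<And>i. continuous_on UNIV (\<phi> i)" and \<phi>_le1: "\<And>i y. norm (\<phi> i y) \<le> 1"
begin

lemma \<phi>_meas [measurable]: "\<phi> i \<in> borel_measurable borel"
  by (rule borel_measurable_continuous_onI[OF \<phi>_cont])

lemma prod_\<phi>_le1: "norm (\<Prod>i\<in>I. \<phi> i (y i)) \<le> 1"
  by (simp add: prod_norm[symmetric] prod_le_1 \<phi>_le1)

lemma time_le: "i \<le> m \<Longrightarrow> r + real i * \<delta> \<le> T"
  using rT \<delta>0 mult_right_mono[of "real i" "real m" \<delta>] by linarith

lemma time_ge: "r \<le> r + real i * \<delta>"
  using \<delta>0 by simp

lemma r_le_T: "r \<le> T"
  using time_le[of 0] by simp

lemma X0_meas: "i \<le> m \<Longrightarrow> X r 0 (r + real i * \<delta>) \<in> borel_measurable M"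
  using r0 time_le time_ge r_le_T by (intro X_meas) auto

text \<open>All factors are expressed through the single variable \<open>X t x r\<close> and the
  processes started at (r, 0), the two parts to be separated by independence.\<close>

lemma markov_avg_flow:
  assumes t: "0 \<le> t" "t \<le> r"
  shows "markov_avg \<phi> r \<delta> m t x
    = (\<integral>\<omega>. (\<Prod>i\<le>m. \<phi> i (exp (b * (real i * \<delta>)) * X t x r \<omega> + X r 0 (r + real i * \<delta>) \<omega>)) \<partial>M)"
  unfolding markov_avg_def
proof (rule integral_cong_AE)
  have tT: "t \<in> {0..T}" "r \<in> {t..T}" using t r_le_T by auto
  have [measurable]: "X t x r \<in> borel_measurable M" using tT by (rule X_meas)
  show "(\<lambda>\<omega>. \<Prod>i\<le>m. \<phi> i (X t x (r + real i * \<delta>) \<omega>)) \<in> borel_measurable M"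
  proof (intro borel_measurable_prod measurable_compose[OF _ \<phi>_meas] X_meas)
    fix i assume i: "i \<in> {..m}"
    show "t \<in> {0..T}" by (rule tT)
    show "r + real i * \<delta> \<in> {t..T}" using time_le[of i] time_ge[of i] i t by auto
  qed
  show "(\<lambda>\<omega>. \<Prod>i\<le>m. \<phi> i (exp (b * (real i * \<delta>)) * X t x r \<omega> + X r 0 (r + real i * \<delta>) \<omega>)) \<in> borel_measurable M"
    by (intro borel_measurable_prod measurable_compose[OF _ \<phi>_meas] borel_measurable_add
        borel_measurable_times X0_meas) auto
  have "AE \<omega> in M. \<forall>i\<in>{..m}. X t x (r + real i * \<delta>) \<omega> = exp (b * (r + real i * \<delta> - r)) * X t x r \<omega> + X r 0 (r + real i * \<delta>) \<omega>"
    using X_flow[OF t time_ge time_le] by (intro AE_finite_allI) auto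
  thus "AE \<omega> in M. (\<Prod>i\<le>m. \<phi> i (X t x (r + real i * \<delta>) \<omega>))
      = (\<Prod>i\<le>m. \<phi> i (exp (b * (real i * \<delta>)) * X t x r \<omega> + X r 0 (r + real i * \<delta>) \<omega>))"
    by eventually_elim (auto intro!: prod.cong)
qed

lemma markov_avg_at_r:
  "markov_avg \<phi> r \<delta> m r y
    = (\<integral>\<omega>. (\<Prod>i\<le>m. \<phi> i (exp (b * (real i * \<delta>)) * y + X r 0 (r + real i * \<delta>) \<omega>)) \<partial>M)"
  unfolding markov_avg_flow[OF r0 order_refl]
proof (rule integral_cong_AE)
  have rT': "r \<in> {0..T}" "r \<in> {r..T}" using r0 r_le_T by auto
  have [measurable]: "X r y r \<in> borel_measurable M" using rT' by (rule X_meas)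
  show "(\<lambda>\<omega>. \<Prod>i\<le>m. \<phi> i (exp (b * (real i * \<delta>)) * X r y r \<omega> + X r 0 (r + real i * \<delta>) \<omega>)) \<in> borel_measurable M"
    "(\<lambda>\<omega>. \<Prod>i\<le>m. \<phi> i (exp (b * (real i * \<delta>)) * y + X r 0 (r + real i * \<delta>) \<omega>)) \<in> borel_measurable M"
    by (intro borel_measurable_prod measurable_compose[OF _ \<phi>_meas] borel_measurable_add
        borel_measurable_times X0_meas; simp)+
  from X_start[OF rT'(1), of y]
  show "AE \<omega> in M. (\<Prod>i\<le>m. \<phi> i (exp (b * (real i * \<delta>)) * X r y r \<omega> + X r 0 (r + real i * \<delta>) \<omega>))
      = (\<Prod>i\<le>m. \<phi> i (exp (b * (real i * \<delta>)) * y + X r 0 (r + real i * \<delta>) \<omega>))"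
    by eventually_elim simp
qed

lemma markov_avg_le1: "norm (markov_avg \<phi> r \<delta> m t x) \<le> 1"
  unfolding markov_avg_def by (rule norm_integral_le_1) (rule prod_\<phi>_le1)

text \<open>By \<open>markov_avg_at_r\<close> the starting point occurs only inside the continuous
  factors, so dominated convergence applies although nothing is assumed on how \<open>X r y\<close>
  depends on \<open>y\<close>.\<close>

lemma continuous_markov_avg: "continuous_on UNIV (markov_avg \<phi> r \<delta> m r)"
proof (rule continuous_on_sequentiallyI)
  fix u :: "nat \<Rightarrow> real" and y assume lim: "u \<longlonglongrightarrow> y"
  have [measurable]: "(\<lambda>\<omega>. \<Prod>i\<le>m. \<phi> i (exp (b * (real i * \<delta>)) * y + X r 0 (r + real i * \<delta>) \<omega>)) \<in> borel_measurable M" for y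
    by (intro borel_measurable_prod measurable_compose[OF _ \<phi>_meas] borel_measurable_add
        borel_measurable_times X0_meas) auto
  show "(\<lambda>n. markov_avg \<phi> r \<delta> m r (u n)) \<longlonglongrightarrow> markov_avg \<phi> r \<delta> m r y"
    unfolding markov_avg_at_r
  proof (rule integral_dominated_convergence[where w = "\<lambda>_. 1"])
    show "AE \<omega> in M. (\<lambda>n. \<Prod>i\<le>m. \<phi> i (exp (b * (real i * \<delta>)) * u n + X r 0 (r + real i * \<delta>) \<omega>))
        \<longlonglongrightarrow> (\<Prod>i\<le>m. \<phi> i (exp (b * (real i * \<delta>)) * y + X r 0 (r + real i * \<delta>) \<omega>))"
      by (intro AE_I2 tendsto_prod continuous_on_tendsto_compose[OF \<phi>_cont] tendsto_intros lim) auto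
  qed (auto intro: prod_\<phi>_le1)
qed

text \<open>The Markov property for the approximating sums: \<open>G\<close> and all the
  \<open>H i\<close> read disjoint blocks of increments, so the integral over one \<omega> splits
  into a double integral.\<close>

lemma ou_sum_split_integral:
  assumes t: "0 \<le> t" "t \<le> r" and N: "0 < N"
  defines "G \<equiv> \<lambda>\<omega>. ou_sum b c (\<lambda>u. W u \<omega>) t r N"
    and "H \<equiv> \<lambda>i \<omega>. ou_sum b c (\<lambda>u. W u \<omega>) r (r + real i * \<delta>) (i * N)"
  shows "(\<integral>\<omega>. (\<Prod>i\<le>m. \<phi> i (\<kappa> i * (\<mu> + G \<omega>) + (\<nu> i + H i \<omega>))) \<partial>M)
    = (\<integral>\<omega>. (\<integral>\<omega>'. (\<Prod>i\<le>m. \<phi> i (\<kappa> i * (\<mu> + G \<omega>) + (\<nu> i + H i \<omega>'))) \<partial>M) \<partial>M)"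
proof -
  \<comment> \<open>One increasing time sequence covers both sides of \<open>r\<close>: N steps on
    [t, r], then steps of length \<delta> / N. With \<open>i * N\<close> points, \<open>H i\<close>
    has this mesh for every positive \<open>i\<close>, so all of them share the increments
    \<open>Z (N + k)\<close>.\<close>
  define ts where "ts = (\<lambda>k. if k \<le> N then grid t r N k else r + real (k - N) * \<delta> / real N)"
  define Z where "Z = (\<lambda>k \<omega>. W (ts (Suc k)) \<omega> - W (ts k) \<omega>)"
  define A where "A = {..<N}"
  define B where "B = {N..<N + m * N}"
  define g where "g = (\<lambda>z. \<Sum>k<N. c * exp (b * (r - grid t r N k)) * z k)"
  define h where "h = (\<lambda>i z. \<Sum>k<i * N. c * exp (b * (r + real i * \<delta> - grid r (r + real i * \<delta>) (i * N) k)) * z (N + k))"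
  define \<Psi> where "\<Psi> = (\<lambda>(z, z'). \<Prod>i\<le>m. \<phi> i (\<kappa> i * (\<mu> + g z) + (\<nu> i + h i z')))"
  have ts_high: "ts (N + k) = r + real k * \<delta> / real N" for k
    using N by (cases "k = 0") (auto simp: ts_def)
  have tmono: "ts k \<le> ts (Suc k)" for k
  proof (cases "k < N")
    case True
    thus ?thesis using t grid_mono[of t r k "Suc k" N] by (simp add: ts_def)
  next
    case False
    then obtain l where k: "k = N + l" using le_Suc_ex not_less by blast
    show ?thesis using ts_high[of l] ts_high[of "Suc l"] \<delta>0 N
      unfolding k by (simp add: divide_right_mono mult_right_mono)
  qed
  have "indep_vars (\<lambda>_. borel) Z {..<N + m * N}"
    unfolding Z_def using t tmono by (intro increments_indep) (auto simp: ts_def)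
  hence ind: "indep_var (PiM A (\<lambda>_. borel)) (\<lambda>\<omega>. \<lambda>i\<in>A. Z i \<omega>) (PiM B (\<lambda>_. borel)) (\<lambda>\<omega>. \<lambda>i\<in>B. Z i \<omega>)"
    by (rule indep_var_restrict) (auto simp: A_def B_def)
  have g_meas: "g \<in> borel_measurable (PiM A (\<lambda>_. borel))"
    unfolding g_def A_def by (intro borel_measurable_sum borel_measurable_times) auto
  have h_meas: "h i \<in> borel_measurable (PiM B (\<lambda>_. borel))" if "i \<le> m" for i
    unfolding h_def
  proof (intro borel_measurable_sum borel_measurable_times)
    fix k assume "k \<in> {..<i * N}"
    hence "k < m * N" using that by (meson lessThan_iff less_le_trans mult_le_mono1)
    hence "N + k \<in> B" by (simp add: B_def)
    thus "(\<lambda>z. z (N + k)) \<in> borel_measurable (PiM B (\<lambda>_. borel))"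
      by (rule measurable_component_singleton)
  qed auto
  have \<Psi>_meas: "\<Psi> \<in> borel_measurable (PiM A (\<lambda>_. borel) \<Otimes>\<^sub>M PiM B (\<lambda>_. borel))"
    unfolding \<Psi>_def case_prod_unfold
    by (intro borel_measurable_prod measurable_compose[OF _ \<phi>_meas] borel_measurable_add
        borel_measurable_times measurable_compose[OF measurable_fst g_meas]
        measurable_compose[OF measurable_snd h_meas]) auto
  have "norm (\<Psi> p) \<le> 1" for p
    unfolding \<Psi>_def case_prod_unfold by (rule prod_\<phi>_le1)
  note split = indep_var_integral_pair[OF ind \<Psi>_meas this]
  have gG: "g (\<lambda>i\<in>A. Z i \<omega>) = G \<omega>" for \<omega>
    unfolding g_def G_def ou_sum_def by (intro sum.cong) (auto simp: A_def Z_def ts_def)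
  have hH: "h i (\<lambda>i\<in>B. Z i \<omega>) = H i \<omega>" if "i \<le> m" for i \<omega>
    unfolding h_def H_def ou_sum_def
  proof (rule sum.cong)
    fix k assume k: "k \<in> {..<i * N}"
    hence "k < m * N" using that by (meson lessThan_iff less_le_trans mult_le_mono1)
    hence B: "N + k \<in> B" by (simp add: B_def)
    have i: "0 < i" using k by (cases i) auto
    have gr: "grid r (r + real i * \<delta>) (i * N) l = ts (N + l)" for l
      unfolding ts_high grid_def using i N by simp
    show "c * exp (b * (r + real i * \<delta> - grid r (r + real i * \<delta>) (i * N) k)) * (\<lambda>i\<in>B. Z i \<omega>) (N + k)
      = c * exp (b * (r + real i * \<delta> - grid r (r + real i * \<delta>) (i * N) k)) *
       (W (grid r (r + real i * \<delta>) (i * N) (Suc k)) \<omega> - W (grid r (r + real i * \<delta>) (i * N) k) \<omega>)"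
      unfolding gr using B by (simp add: Z_def)
  qed simp
  have "\<Psi> ((\<lambda>i\<in>A. Z i \<omega>), (\<lambda>i\<in>B. Z i \<omega>')) = (\<Prod>i\<le>m. \<phi> i (\<kappa> i * (\<mu> + G \<omega>) + (\<nu> i + H i \<omega>')))" for \<omega> \<omega>'
    unfolding \<Psi>_def prod.case gG by (intro prod.cong refl) (simp add: hH)
  with split show ?thesis by simp
qed

text \<open>Both sides of \<open>ou_sum_split_integral\<close> are sent to their limits. On the left
  both sums follow one path; on the right the inner integral converges first, at the point reached
  by the outer path.\<close>

lemma markov_property:
  assumes t: "0 \<le> t" "t \<le> r"
  shows "markov_avg \<phi> r \<delta> m t x = (\<integral>\<omega>. markov_avg \<phi> r \<delta> m r (X t x r \<omega>) \<partial>M)"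
proof -
  define \<kappa> where "\<kappa> = (\<lambda>i. exp (b * (real i * \<delta>)))"
  define \<nu> where "\<nu> = (\<lambda>i. a * expm1_quot b (real i * \<delta>))"
  define \<mu> where "\<mu> = exp (b * (r - t)) * x + a * expm1_quot b (r - t)"
  define G where "G = (\<lambda>N \<omega>. ou_sum b c (\<lambda>u. W u \<omega>) t r N)"
  define H where "H = (\<lambda>N i \<omega>. ou_sum b c (\<lambda>u. W u \<omega>) r (r + real i * \<delta>) (i * N))"
  define Y where "Y = (\<lambda>i. X r 0 (r + real i * \<delta>))"
  have tT: "t \<in> {0..T}" "r \<in> {t..T}" and rT': "r \<in> {0..T}" using t r_le_T by auto
  have [measurable]: "X t x r \<in> borel_measurable M" using tT by (rule X_meas)
  have [measurable]: "G N \<in> borel_measurable M" for N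
    unfolding G_def using t by (intro ou_sum_meas) auto
  have [measurable]: "H N i \<in> borel_measurable M" for N i
    unfolding H_def by (intro ou_sum_meas r0 time_ge)
  have Y_meas: "i \<in> {..m} \<Longrightarrow> Y i \<in> borel_measurable M" for i
    unfolding Y_def using X0_meas by simp
  have G_lim: "AE \<omega> in M. (\<lambda>N. \<mu> + G N \<omega>) \<longlonglongrightarrow> X t x r \<omega>"
    using X_limit[OF t(1) order_refl t(2) r_le_T, of x] X_start[OF tT(1), of x]
  proof eventually_elim
    case (elim \<omega>)
    from tendsto_add[OF tendsto_const[of \<mu>] elim(1)] elim(2) show ?case by (simp add: \<mu>_def G_def)
  qed
  have H_lim: "AE \<omega> in M. \<forall>i\<in>{..m}. (\<lambda>N. \<nu> i + H N i \<omega>) \<longlonglongrightarrow> Y i \<omega>"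
  proof (rule AE_finite_allI)
    fix i assume i: "i \<in> {..m}"
    from X_limit[OF r0 order_refl time_ge time_le, of i 0] i X_start[OF rT', of 0]
    have "AE \<omega> in M. (\<lambda>N. ou_sum b c (\<lambda>u. W u \<omega>) r (r + real i * \<delta>) N) \<longlonglongrightarrow> Y i \<omega> - \<nu> i"
      by (auto simp: Y_def \<nu>_def)
    thus "AE \<omega> in M. (\<lambda>N. \<nu> i + H N i \<omega>) \<longlonglongrightarrow> Y i \<omega>"
    proof eventually_elim
      case (elim \<omega>)
      have "(\<lambda>N. H N i \<omega>) \<longlonglongrightarrow> Y i \<omega> - \<nu> i"
      proof (cases "i = 0")
        case True
        thus ?thesis using elim by (simp add: H_def)
      next
        case False
        \<comment> \<open>\<open>H N i\<close> is the subsequence of sums with \<open>i * N\<close>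
          points. For \<open>i = 0\<close> it is constant and was treated above.\<close>
        hence "filterlim (\<lambda>N. i * N) at_top sequentially" by (intro mult_nat_left_at_top) auto
        thus ?thesis unfolding H_def by (rule filterlim_compose[OF elim])
      qed
      from tendsto_add[OF tendsto_const[of "\<nu> i"] this] show ?case by simp
    qed
  qed simp
  have L: "(\<lambda>N. \<integral>\<omega>. (\<Prod>i\<le>m. \<phi> i (\<kappa> i * (\<mu> + G N \<omega>) + (\<nu> i + H N i \<omega>))) \<partial>M)
      \<longlonglongrightarrow> (\<integral>\<omega>. (\<Prod>i\<le>m. \<phi> i (\<kappa> i * X t x r \<omega> + Y i \<omega>)) \<partial>M)"
  proof (rule integral_dominated_convergence[where w = "\<lambda>_. 1"])
    show "(\<lambda>\<omega>. \<Prod>i\<le>m. \<phi> i (\<kappa> i * X t x r \<omega> + Y i \<omega>)) \<in> borel_measurable M"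
      by (intro borel_measurable_prod measurable_compose[OF _ \<phi>_meas] borel_measurable_add
        borel_measurable_times Y_meas) auto
    from G_lim H_lim
    show "AE \<omega> in M. (\<lambda>N. \<Prod>i\<le>m. \<phi> i (\<kappa> i * (\<mu> + G N \<omega>) + (\<nu> i + H N i \<omega>)))
        \<longlonglongrightarrow> (\<Prod>i\<le>m. \<phi> i (\<kappa> i * X t x r \<omega> + Y i \<omega>))"
    proof eventually_elim
      case (elim \<omega>)
      show ?case
        by (intro tendsto_prod continuous_on_tendsto_compose[OF \<phi>_cont] tendsto_add tendsto_mult
            tendsto_const elim(1) elim(2)[rule_format]) auto
    qed
  qed (auto intro: prod_\<phi>_le1)
  have R: "(\<lambda>N. \<integral>\<omega>. (\<integral>\<omega>'. (\<Prod>i\<le>m. \<phi> i (\<kappa> i * (\<mu> + G N \<omega>) + (\<nu> i + H N i \<omega>'))) \<partial>M) \<partial>M)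
      \<longlonglongrightarrow> (\<integral>\<omega>. markov_avg \<phi> r \<delta> m r (X t x r \<omega>) \<partial>M)"
  proof (rule integral_dominated_convergence[where w = "\<lambda>_. 1"])
    show "(\<lambda>\<omega>. markov_avg \<phi> r \<delta> m r (X t x r \<omega>)) \<in> borel_measurable M"
      by (rule measurable_compose[OF _ borel_measurable_continuous_onI[OF continuous_markov_avg]]) measurable
    show "(\<lambda>\<omega>. \<integral>\<omega>'. (\<Prod>i\<le>m. \<phi> i (\<kappa> i * (\<mu> + G N \<omega>) + (\<nu> i + H N i \<omega>'))) \<partial>M) \<in> borel_measurable M" for N
      by measurable
    show "AE \<omega> in M. norm (\<integral>\<omega>'. (\<Prod>i\<le>m. \<phi> i (\<kappa> i * (\<mu> + G N \<omega>) + (\<nu> i + H N i \<omega>'))) \<partial>M) \<le> 1" for N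
      by (intro AE_I2 norm_integral_le_1 prod_\<phi>_le1)
    \<comment> \<open>With the outer path fixed, \<mu> + \<open>G N \<omega>\<close> is a convergent
      number sequence, and \<open>markov_avg_at_r\<close> identifies the limit of the integral over
      \<omega>'.\<close>
    from G_lim show "AE \<omega> in M. (\<lambda>N. \<integral>\<omega>'. (\<Prod>i\<le>m. \<phi> i (\<kappa> i * (\<mu> + G N \<omega>) + (\<nu> i + H N i \<omega>'))) \<partial>M)
        \<longlonglongrightarrow> markov_avg \<phi> r \<delta> m r (X t x r \<omega>)"
    proof eventually_elim
      case (elim \<omega>)
      show ?case
        unfolding markov_avg_at_r \<kappa>_def[symmetric]
      proof (rule integral_dominated_convergence[where w = "\<lambda>_. 1"])
        show "(\<lambda>\<omega>'. \<Prod>i\<le>m. \<phi> i (exp (b * (real i * \<delta>)) * X t x r \<omega> + X r 0 (r + real i * \<delta>) \<omega>')) \<in> borel_measurable M"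
          by (intro borel_measurable_prod measurable_compose[OF _ \<phi>_meas] borel_measurable_add
            borel_measurable_times X0_meas) auto
        from H_lim
        show "AE \<omega>' in M. (\<lambda>N. \<Prod>i\<le>m. \<phi> i (\<kappa> i * (\<mu> + G N \<omega>) + (\<nu> i + H N i \<omega>')))
            \<longlonglongrightarrow> (\<Prod>i\<le>m. \<phi> i (exp (b * (real i * \<delta>)) * X t x r \<omega> + X r 0 (r + real i * \<delta>) \<omega>'))"
          unfolding \<kappa>_def Y_def
        proof eventually_elim
          case (elim \<omega>')
          show ?case
            by (intro tendsto_prod continuous_on_tendsto_compose[OF \<phi>_cont] tendsto_add tendsto_mult
                tendsto_const \<open>(\<lambda>N. \<mu> + G N \<omega>) \<longlonglongrightarrow> X t x r \<omega>\<close> elim[rule_format]) auto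
        qed
      qed (auto intro: prod_\<phi>_le1)
    qed
  qed simp
  have "\<forall>\<^sub>F N in sequentially.
      (\<integral>\<omega>. (\<integral>\<omega>'. (\<Prod>i\<le>m. \<phi> i (\<kappa> i * (\<mu> + G N \<omega>) + (\<nu> i + H N i \<omega>'))) \<partial>M) \<partial>M)
      = (\<integral>\<omega>. (\<Prod>i\<le>m. \<phi> i (\<kappa> i * (\<mu> + G N \<omega>) + (\<nu> i + H N i \<omega>))) \<partial>M)"
    using eventually_gt_at_top[of 0] unfolding G_def H_def
    by eventually_elim (rule ou_sum_split_integral[OF t, symmetric])
  from LIMSEQ_unique[OF L Lim_transform_eventually[OF R this]] show ?thesis
    unfolding markov_avg_flow[OF t] \<kappa>_def Y_def .
qed

lemma markov_avg_eq_gauss_avg: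
  assumes t: "0 \<le> t" "t \<le> r"
  shows "markov_avg \<phi> r \<delta> m t x = gauss_avg (markov_avg \<phi> r \<delta> m r)
     (exp (b * (r - t)) * x + a * expm1_quot b (r - t)) (sqrt (c\<^sup>2 * expm1_quot (2 * b) (r - t)))"
  unfolding markov_property[OF t]
  by (rule expectation_X[OF t r_le_T continuous_markov_avg markov_avg_le1])

end

end

section \<open>Smoothness and the backward equation\<close>

locale gaussian_semigroup = bounded_terminal F for F :: "real \<Rightarrow> complex" +
  fixes a b c r :: real
  assumes c_nonzero: "c \<noteq> 0"
begin

definition drift :: "real \<Rightarrow> real \<Rightarrow> real" where
  "drift t x = exp (b * (r - t)) * x + a * expm1_quot b (r - t)"

definition var :: "real \<Rightarrow> real" where
  "var t = c\<^sup>2 * expm1_quot (2 * b) (r - t)"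

definition J :: "nat \<Rightarrow> real \<Rightarrow> real \<Rightarrow> complex" where
  "J k t x = gauss_moment F k (var t) (drift t x)"

lemma var_pos: "t < r \<Longrightarrow> 0 < var t"
  using c_nonzero expm1_quot_pos by (simp add: var_def)

lemma continuous_on_var: "continuous_on S var"
  unfolding var_def[abs_def] by (intro continuous_intros)

lemma continuous_on_J: "continuous_on ({..<r} \<times> UNIV) (\<lambda>(t, x). J k t x)"
proof -
  have "continuous_on ({..<r} \<times> UNIV) (\<lambda>p. (\<lambda>(v, m). gauss_moment F k v m) (var (fst p), drift (fst p) (snd p)))"
    by (rule continuous_on_compose2[OF continuous_on_gauss_moment])
       (auto simp: var_def drift_def var_pos[unfolded var_def] intro!: continuous_intros)
  thus ?thesis by (simp add: J_def case_prod_unfold)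
qed

lemma J_deriv_x:
  assumes t: "t < r"
  shows "(J k t has_vector_derivative
      (- real k * exp (b * (r - t))) *\<^sub>R J (k - 1) t x + (exp (b * (r - t)) / var t) *\<^sub>R J (k + 1) t x) (at x)"
proof -
  have "((\<lambda>x. gauss_moment F k (var t) (drift t x)) has_vector_derivative
      (- real k * exp (b * (r - t))) *\<^sub>R gauss_moment F (k - 1) (var t) (drift t x)
      + (exp (b * (r - t)) / var t) *\<^sub>R gauss_moment F (k + 1) (var t) (drift t x)
      + (0 / (2 * (var t)\<^sup>2)) *\<^sub>R gauss_moment F (k + 2) (var t) (drift t x)) (at x)"
    by (rule gauss_moment_has_vector_derivative[where l = "x - 1" and u = "x + 1" and v = "\<lambda>_. var t" and v' = "\<lambda>_. 0"
        and m' = "\<lambda>_. exp (b * (r - t))"])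
       (auto simp: drift_def[abs_def] var_pos[OF t] intro!: derivative_eq_intros)
  thus ?thesis by (simp add: J_def[abs_def])
qed

text \<open>Both parameters move with \<open>t\<close>: the mean at speed -(a + b x) e^(b (r - t)),
  the variance at speed -c^2 e^(2 b (r - t)). Index 0 suffices because only f itself is
  differentiated in time.\<close>

lemma J_deriv_t:
  assumes t: "t < r"
  shows "((\<lambda>s. J 0 s x) has_vector_derivative
      (- (a + b * x) * exp (b * (r - t)) / var t) *\<^sub>R J 1 t x
      + (- c\<^sup>2 * exp (2 * b * (r - t)) / (2 * (var t)\<^sup>2)) *\<^sub>R J 2 t x) (at t)"
proof -
  have "((\<lambda>s. gauss_moment F 0 (var s) (drift s x)) has_vector_derivative
      (- real 0 * (- (a + b * x) * exp (b * (r - t)))) *\<^sub>R gauss_moment F (0 - 1) (var t) (drift t x)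
      + (- (a + b * x) * exp (b * (r - t)) / var t) *\<^sub>R gauss_moment F (0 + 1) (var t) (drift t x)
      + (- c\<^sup>2 * exp (2 * b * (r - t)) / (2 * (var t)\<^sup>2)) *\<^sub>R gauss_moment F (0 + 2) (var t) (drift t x)) (at t)"
    by (rule gauss_moment_has_vector_derivative[where l = "t - 1" and u = r
        and m' = "\<lambda>t. - (a + b * x) * exp (b * (r - t))" and v' = "\<lambda>t. - c\<^sup>2 * exp (2 * b * (r - t))"])
       (auto simp: drift_def[abs_def] var_def[abs_def] expm1_quot_pos c_nonzero t algebra_simps
         intro!: derivative_eq_intros continuous_intros)
  thus ?thesis by (simp add: J_def numeral_2_eq_2)
qed

text \<open>Members are jointly continuous and have an x-derivative of the same kind, because the
  coefficients depend on \<open>t\<close> alone. Derivatives of all orders follow without a closed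
  formula for them.\<close>

inductive gauss_comb :: "(real \<Rightarrow> real \<Rightarrow> complex) \<Rightarrow> bool" where
  single: "continuous_on {..<r} \<beta> \<Longrightarrow> gauss_comb (\<lambda>t x. \<beta> t *\<^sub>R J k t x)"
| add: "gauss_comb g \<Longrightarrow> gauss_comb h \<Longrightarrow> gauss_comb (\<lambda>t x. g t x + h t x)"

lemma gauss_comb_continuous:
  "gauss_comb g \<Longrightarrow> continuous_on ({..<r} \<times> UNIV) (\<lambda>(t, x). g t x)"
proof (induction rule: gauss_comb.induct)
  case (single \<beta> k)
  have "continuous_on ({..<r} \<times> (UNIV :: real set)) (\<lambda>p. \<beta> (fst p))"
    by (rule continuous_on_compose2[OF single]) (auto intro!: continuous_intros)
  from continuous_on_scaleR[OF this continuous_on_J] show ?case by (simp add: case_prod_unfold)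
next
  case (add g h)
  from continuous_on_add[OF add.IH] show ?case by (simp add: case_prod_unfold)
qed

lemma gauss_comb_deriv:
  "gauss_comb g \<Longrightarrow> \<exists>g'. gauss_comb g' \<and> (\<forall>t<r. \<forall>x. (g t has_vector_derivative g' t x) (at x))"
proof (induction rule: gauss_comb.induct)
  case (single \<beta> k)
  define e where "e = (\<lambda>t. exp (b * (r - t)))"
  have "gauss_comb (\<lambda>t x. (\<beta> t * (- real k * e t)) *\<^sub>R J (k - 1) t x + (\<beta> t * (e t / var t)) *\<^sub>R J (k + 1) t x)"
    using var_pos unfolding e_def
    by (intro gauss_comb.intros continuous_intros single continuous_on_var) force+
  moreover have "((\<lambda>x. \<beta> t *\<^sub>R J k t x) has_vector_derivative
      (\<beta> t * (- real k * e t)) *\<^sub>R J (k - 1) t x + (\<beta> t * (e t / var t)) *\<^sub>R J (k + 1) t x) (at x)" if "t < r" for t x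
    using has_vector_derivative_scaleR[OF DERIV_const[of "\<beta> t"] J_deriv_x[OF that]]
    by (simp add: e_def scaleR_add_right scaleR_diff_right)
  ultimately show ?case by blast
next
  case (add g h)
  then obtain g' h' where "gauss_comb g'" "gauss_comb h'"
    "\<forall>t<r. \<forall>x. (g t has_vector_derivative g' t x) (at x)"
    "\<forall>t<r. \<forall>x. (h t has_vector_derivative h' t x) (at x)" by blast
  thus ?case
    by (intro exI[of _ "\<lambda>t x. g' t x + h' t x"]) (auto intro: gauss_comb.add has_vector_derivative_add)
qed

definition coef :: "real \<Rightarrow> real" where
  "coef t = 1 / sqrt (2 * pi * var t)"

lemma continuous_on_coef: "continuous_on {..<r} coef"
  unfolding coef_def[abs_def] using var_pos
  by (intro continuous_intros continuous_on_var) force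

lemma semigroup_eq:
  assumes "t < r"
  shows "gauss_avg F (drift t x) (sqrt (var t)) = coef t *\<^sub>R J 0 t x"
  unfolding coef_def J_def by (rule gauss_avg_eq_gauss_moment[OF var_pos[OF assms] F_meas])

lemma gauss_comb_semigroup: "gauss_comb (\<lambda>t x. coef t *\<^sub>R J 0 t x)"
  by (rule gauss_comb.single[OF continuous_on_coef])

lemma coef_deriv:
  assumes t: "t < r"
  shows "(coef has_real_derivative coef t * (c\<^sup>2 * exp (2 * b * (r - t)) / (2 * var t))) (at t)"
proof -
  note v = var_pos[OF t]
  have dv: "(var has_real_derivative - c\<^sup>2 * exp (2 * b * (r - t))) (at t)"
    unfolding var_def[abs_def] by (auto intro!: derivative_eq_intros)
  \<comment> \<open>The derivative of the inverse square root is a multiple of i^3; only the factor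
    \<open>i * i\<close> is evaluated, which leaves one \<open>i\<close> standing for
    \<open>coef t\<close>.\<close>
  define i where "i = inverse (sqrt (2 * pi * var t))"
  have i2: "i * i = 1 / (2 * pi * var t)"
    using v by (simp add: i_def inverse_mult_distrib[symmetric] divide_inverse del: inverse_mult_distrib)
  have "((\<lambda>t. inverse (sqrt (2 * pi * var t))) has_real_derivative
      - (i * (i / 2 * (2 * pi * (- c\<^sup>2 * exp (2 * b * (r - t))))) * i)) (at t)"
    unfolding i_def using v by (intro DERIV_inverse' DERIV_chain2[OF DERIV_real_sqrt] DERIV_cmult dv) auto
  moreover have "- (i * (i / 2 * (2 * pi * (- c\<^sup>2 * exp (2 * b * (r - t))))) * i)
      = i * ((i * i) * (pi * (c\<^sup>2 * exp (2 * b * (r - t)))))"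
    by (simp add: algebra_simps)
  moreover have "(i * i) * (pi * (c\<^sup>2 * exp (2 * b * (r - t)))) = c\<^sup>2 * exp (2 * b * (r - t)) / (2 * var t)"
    unfolding i2 using v by (simp add: field_simps)
  ultimately have "((\<lambda>t. inverse (sqrt (2 * pi * var t))) has_real_derivative
      i * (c\<^sup>2 * exp (2 * b * (r - t)) / (2 * var t))) (at t)"
    by (simp only:)
  thus ?thesis unfolding coef_def[abs_def] i_def inverse_eq_divide .
qed

context
  fixes f :: "real \<Rightarrow> real \<Rightarrow> complex" and l :: real
  assumes f: "\<And>t x. t \<in> {l<..<r} \<Longrightarrow> f t x = gauss_avg F (drift t x) (sqrt (var t))"
begin

lemma f_eq: "t \<in> {l<..<r} \<Longrightarrow> f t x = coef t *\<^sub>R J 0 t x"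
  using f semigroup_eq by simp

definition ft :: "real \<Rightarrow> real \<Rightarrow> complex" where
  "ft t x = coef t *\<^sub>R ((- (a + b * x) * exp (b * (r - t)) / var t) *\<^sub>R J 1 t x
      + (- c\<^sup>2 * exp (2 * b * (r - t)) / (2 * (var t)\<^sup>2)) *\<^sub>R J 2 t x)
    + (coef t * (c\<^sup>2 * exp (2 * b * (r - t)) / (2 * var t))) *\<^sub>R J 0 t x"

lemma f_deriv_t:
  assumes t: "t \<in> {l<..<r}"
  shows "((\<lambda>s. f s x) has_vector_derivative ft t x) (at t)"
proof (rule has_vector_derivative_transform_within_open[where S = "{l<..<r}"])
  show "((\<lambda>s. coef s *\<^sub>R J 0 s x) has_vector_derivative ft t x) (at t)"
    unfolding ft_def using t by (intro has_vector_derivative_scaleR coef_deriv J_deriv_t) auto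
qed (use t f_eq in auto)

lemma f_deriv_x:
  assumes t: "t \<in> {l<..<r}"
  shows "((\<lambda>y. f t y) has_vector_derivative (coef t * (exp (b * (r - t)) / var t)) *\<^sub>R J 1 t x) (at x)"
proof -
  have "t < r" using t by simp
  from has_vector_derivative_scaleR[OF DERIV_const[of "coef t"] J_deriv_x[OF this, of 0]]
  show ?thesis using t by (simp add: f_eq)
qed

lemma f_deriv_xx:
  assumes t: "t \<in> {l<..<r}"
  shows "((\<lambda>y. vector_derivative (\<lambda>z. f t z) (at y)) has_vector_derivative
     (coef t * (exp (b * (r - t)) / var t)) *\<^sub>R ((- exp (b * (r - t))) *\<^sub>R J 0 t x
        + (exp (b * (r - t)) / var t) *\<^sub>R J 2 t x)) (at x)"
proof -
  have "t < r" using t by simp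
  from has_vector_derivative_scaleR[OF DERIV_const[of "coef t * (exp (b * (r - t)) / var t)"] J_deriv_x[OF this, of 1]]
  show ?thesis unfolding vector_derivative_at[OF f_deriv_x[OF t]] by (simp add: numeral_2_eq_2)
qed

lemma semigroup_C1_in_t: "C1_in_t ({l<..<r} \<times> UNIV) f"
  unfolding C1_in_t_def
proof (intro exI[of _ ft] conjI ballI)
  have sub: "{l<..<r} \<times> UNIV \<subseteq> {..<r} \<times> (UNIV :: real set)" by auto
  have cJ: "continuous_on ({l<..<r} \<times> UNIV) (\<lambda>p. J k (fst p) (snd p))" for k
    using continuous_on_subset[OF continuous_on_J sub] by (simp add: case_prod_unfold)
  have cv: "continuous_on ({l<..<r} \<times> (UNIV :: real set)) (\<lambda>p. var (fst p))"
    by (rule continuous_on_compose2[OF continuous_on_var[of UNIV]]) (auto intro!: continuous_intros)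
  have cc: "continuous_on ({l<..<r} \<times> (UNIV :: real set)) (\<lambda>p. coef (fst p))"
    by (rule continuous_on_compose2[OF continuous_on_coef]) (auto intro!: continuous_intros)
  have v0: "var (fst p) \<noteq> 0" if "p \<in> {l<..<r} \<times> (UNIV :: real set)" for p
    using var_pos[of "fst p"] that by auto
  show "continuous_on ({l<..<r} \<times> UNIV) (\<lambda>(t, x). ft t x)"
    unfolding ft_def case_prod_unfold using v0 by (intro continuous_intros cJ cv cc ballI) auto
qed (auto intro: f_deriv_t)

lemma semigroup_Cinf_in_x: "Cinf_in_x ({l<..<r} \<times> UNIV) f"
proof -
  \<comment> \<open>Dependent choice iterates \<open>gauss_comb_deriv\<close>; the clause for
    \<open>n = 0\<close> pins the start of the sequence to f itself.\<close>
  have "\<exists>D. \<forall>n. (gauss_comb (D n) \<and> (n = 0 \<longrightarrow> D n = (\<lambda>t x. coef t *\<^sub>R J 0 t x)))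
      \<and> (\<forall>t<r. \<forall>x. (D n t has_vector_derivative D (Suc n) t x) (at x))"
    by (rule dependent_nat_choice) (use gauss_comb_semigroup gauss_comb_deriv in auto)
  then obtain D where D: "\<And>n. gauss_comb (D n)" "D 0 = (\<lambda>t x. coef t *\<^sub>R J 0 t x)"
    "\<And>n t x. t < r \<Longrightarrow> (D n t has_vector_derivative D (Suc n) t x) (at x)" by blast
  show ?thesis unfolding Cinf_in_x_def
  proof (intro exI[of _ D] conjI allI)
    show "continuous_on ({l<..<r} \<times> UNIV) (\<lambda>(t, x). D k t x)" for k
      by (rule continuous_on_subset[OF gauss_comb_continuous[OF D(1)]]) auto
  qed (use D f_eq in auto)
qed

text \<open>The coefficients of \<open>J 0\<close>, \<open>J 1\<close> and \<open>J 2\<close> cancel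
  separately: \<open>J 1\<close> balances the motion of the mean against the drift term,
  \<open>J 2\<close> the motion of the variance against diffusion, and \<open>J 0\<close> the
  derivative of the normalising factor against the rest of the second derivative.\<close>

lemma semigroup_pde:
  assumes t: "t \<in> {l<..<r}"
  shows "vector_derivative (\<lambda>s. f s x) (at t)
         + complex_of_real (a + b * x) * vector_derivative (\<lambda>y. f t y) (at x)
         + complex_of_real (c\<^sup>2 / 2) *
             vector_derivative (\<lambda>y. vector_derivative (\<lambda>z. f t z) (at y)) (at x) = 0"
proof -
  have v: "var t \<noteq> 0" using var_pos[of t] t by auto
  define e where "e = exp (b * (r - t))"
  have e2: "exp (2 * b * (r - t)) = e * e"
    by (simp add: e_def exp_add[symmetric] algebra_simps)
  have "ft t x + (a + b * x) *\<^sub>R (coef t * (e / var t)) *\<^sub>R J 1 t x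
      + (c\<^sup>2 / 2) *\<^sub>R (coef t * (e / var t)) *\<^sub>R ((- e) *\<^sub>R J 0 t x + (e / var t) *\<^sub>R J 2 t x)
    = (coef t * (- (a + b * x) * e / var t) + (a + b * x) * (coef t * (e / var t))) *\<^sub>R J 1 t x
      + (coef t * (- c\<^sup>2 * (e * e) / (2 * (var t)\<^sup>2)) + c\<^sup>2 / 2 * (coef t * (e / var t) * (e / var t))) *\<^sub>R J 2 t x
      + (coef t * (c\<^sup>2 * (e * e) / (2 * var t)) - c\<^sup>2 / 2 * (coef t * (e / var t) * e)) *\<^sub>R J 0 t x"
    unfolding ft_def e2 e_def[symmetric] by (simp add: scaleR_add_left scaleR_add_right scaleR_diff_left algebra_simps)
  also have "coef t * (- (a + b * x) * e / var t) + (a + b * x) * (coef t * (e / var t)) = 0"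
    using v by (simp add: field_simps)
  also have "coef t * (- c\<^sup>2 * (e * e) / (2 * (var t)\<^sup>2)) + c\<^sup>2 / 2 * (coef t * (e / var t) * (e / var t)) = 0"
    using v by (simp add: field_simps power2_eq_square)
  also have "coef t * (c\<^sup>2 * (e * e) / (2 * var t)) - c\<^sup>2 / 2 * (coef t * (e / var t) * e) = 0"
    using v by (simp add: field_simps)
  also have "0 *\<^sub>R J 1 t x + 0 *\<^sub>R J 2 t x + 0 *\<^sub>R J 0 t x = 0" by simp
  finally show ?thesis
    \<comment> \<open>The nested derivative must be rewritten first, since the rule for the first
      derivative would also match inside it.\<close>
    unfolding vector_derivative_at[OF f_deriv_xx[OF t]]
    unfolding vector_derivative_at[OF f_deriv_t[OF t]] vector_derivative_at[OF f_deriv_x[OF t]] e_def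
    by (simp only: scaleR_conv_of_real)
qed

end

end

section \<open>The exponential functional with atoms at the grid times\<close>

theorem theorem7p7:
  fixes M :: "'a measure" and W :: "real \<Rightarrow> 'a \<Rightarrow> real"
    and a b c T :: real
    and X :: "real \<Rightarrow> real \<Rightarrow> real \<Rightarrow> 'a \<Rightarrow> real"
    and u1 u2 u3 v :: "real \<Rightarrow> complex"
    and p p2 p3 q :: "nat \<Rightarrow> real"
    and n j :: nat
    and f :: "real \<Rightarrow> real \<Rightarrow> complex"
  assumes BM: "brownian_motion M W"
    and c_ne: "c \<noteq> 0" and T_pos: "T > 0"
    and X_meas: "\<And>t x s. t \<in> {0..T} \<Longrightarrow> s \<in> {t..T} \<Longrightarrow> X t x s \<in> borel_measurable M"
    and X_sol: "\<And>t x. t \<in> {0..T} \<Longrightarrow>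
        AE \<omega> in M. continuous_on {t..T} (\<lambda>s. X t x s \<omega>)
          \<and> (\<forall>s\<in>{t..T}. X t x s \<omega> =
               x + integral {t..s} (\<lambda>r. a + b * X t x r \<omega>) + c * (W s \<omega> - W t \<omega>))"
    and u_cont: "continuous_on {0..T} u1" "continuous_on {0..T} u2"
                "continuous_on {0..T} u3" "continuous_on {0..T} v"
    and u_re: "\<And>t. t \<in> {0..T} \<Longrightarrow> Re (u1 t) \<le> 0"
              "\<And>t. t \<in> {0..T} \<Longrightarrow> Re (u2 t) = 0"
              "\<And>t. t \<in> {0..T} \<Longrightarrow> Re (u3 t) = 0"
              "\<And>t. t \<in> {0..T} \<Longrightarrow> Re (v t) = 0"
    and p_negl: "negligible_df p" "negligible_df p2" "negligible_df p3" "negligible_df q"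
    and n_pos: "n \<ge> 1" and j_lt: "j < n"
    and f_def: "f = (\<lambda>t x. integral\<^sup>L M (\<lambda>\<omega>.
        exp ((\<Sum>i\<in>{i. i < n \<and> t \<le> real i * T / real n}.
                 complex_of_real (T / real n) *
                   (u1 (real i * T / real n) * complex_of_real (pseries (pseries_sq p) (X t x (real i * T / real n) \<omega>))
                  + u2 (real i * T / real n) * complex_of_real (pseries p2 (X t x (real i * T / real n) \<omega>))
                  + u3 (real i * T / real n) * complex_of_real (pseries p3 (X t x (real i * T / real n) \<omega>))))
             + v T * complex_of_real (pseries q (X t x T \<omega>)))))"
  shows "continuous_on ({real j * T / real n <.. real (Suc j) * T / real n} \<times> UNIV) (\<lambda>(t, x). f t x)
    \<and> C1_in_t ({real j * T / real n <..< real (Suc j) * T / real n} \<times> UNIV) f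
    \<and> Cinf_in_x ({real j * T / real n <..< real (Suc j) * T / real n} \<times> UNIV) f
    \<and> (\<forall>t\<in>{real j * T / real n <..< real (Suc j) * T / real n}. \<forall>x.
           vector_derivative (\<lambda>s. f s x) (at t)
         + complex_of_real (a + b * x) * vector_derivative (\<lambda>y. f t y) (at x)
         + complex_of_real (c\<^sup>2 / 2) *
             vector_derivative (\<lambda>y. vector_derivative (\<lambda>z. f t z) (at y)) (at x) = 0)
    \<and> (\<forall>x. ((\<lambda>s. f s x) \<longlongrightarrow>
           f (real j * T / real n) x *
             exp (- complex_of_real (T / real n) *
               (u1 (real j * T / real n) * complex_of_real (pseries (pseries_sq p) x)
              + u2 (real j * T / real n) * complex_of_real (pseries p2 x)
              + u3 (real j * T / real n) * complex_of_real (pseries p3 x))))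
           (at_right (real j * T / real n)))
    \<and> (\<forall>x. f T x = exp (v T * complex_of_real (pseries q x)))"
proof -
  have "prob_space M" using BM by (simp add: brownian_motion_def)
  then interpret ou_process M W X a b c T
    using BM c_ne X_meas X_sol by (intro ou_process.intro ou_process_axioms.intro)
  define ti where "ti = (\<lambda>i. real i * T / real n)"
  define e where "e = (\<lambda>i x. complex_of_real (T / real n) *
      (u1 (ti i) * complex_of_real (pseries (pseries_sq p) x)
     + u2 (ti i) * complex_of_real (pseries p2 x)
     + u3 (ti i) * complex_of_real (pseries p3 x)))"
  define eT where "eT = (\<lambda>x. v T * complex_of_real (pseries q x))"
  define r where "r = ti (Suc j)"
  define \<delta> where "\<delta> = T / real n"
  define m where "m = n - Suc j"
  \<comment> \<open>Factor \<open>i\<close> belongs to time \<open>ti (Suc j + i)\<close>. Index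
    \<open>m\<close> lands on \<open>ti n = T\<close>, which carries the terminal factor; larger
    indices repeat it, so that continuity and the bound hold for every \<open>i\<close>.\<close>
  define \<phi> where "\<phi> = (\<lambda>i x. if Suc j + i < n then exp (e (Suc j + i) x) else exp (eT x))"
  define F where "F = markov_avg \<phi> r \<delta> m r"
  have n0: "0 < real n" using n_pos by simp
  have \<delta>0: "0 < \<delta>" using T_pos n0 by (simp add: \<delta>_def)
  have ti_\<delta>: "ti i = real i * \<delta>" for i by (simp add: ti_def \<delta>_def)
  have ti_le_iff: "ti i \<le> ti k \<longleftrightarrow> i \<le> k" and ti_less_iff: "ti i < ti k \<longleftrightarrow> i < k" for i k
    using \<delta>0 by (auto simp: ti_\<delta>)
  have ti_n: "ti n = T" using n0 by (simp add: ti_def)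
  have ti_in: "ti i \<in> {0..T}" if "i \<le> n" for i
  proof -
    have "0 \<le> ti i" using \<delta>0 by (simp add: ti_\<delta>)
    moreover have "ti i \<le> T" using that ti_le_iff[of i n] ti_n by simp
    ultimately show ?thesis by simp
  qed
  have time: "r + real i * \<delta> = ti (Suc j + i)" for i by (simp add: r_def ti_\<delta> algebra_simps)
  have r: "0 \<le> r" "0 \<le> \<delta>" "r + real m * \<delta> \<le> T"
    using ti_in[of "Suc j"] \<delta>0 j_lt ti_n unfolding time by (auto simp: r_def m_def)
  have psq: "pseries (pseries_sq p) = (\<lambda>x. (pseries p x)\<^sup>2)"
    using pseries_pseries_sq[OF p_negl(1)] by auto
  have \<phi>_cont: "continuous_on UNIV (\<phi> i)" for i
    unfolding \<phi>_def e_def eT_def psq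
    by (cases "Suc j + i < n") (auto intro!: continuous_intros continuous_pseries p_negl)
  \<comment> \<open>The modulus of exp z is e^(Re z), and here Re z <= 0: the u_1 term multiplies a
    square, the other terms are imaginary.\<close>
  have \<phi>_le1: "norm (\<phi> i y) \<le> 1" for i y
  proof (cases "Suc j + i < n")
    case True
    hence *: "ti (Suc j + i) \<in> {0..T}" by (intro ti_in) simp
    have "Re (u1 (ti (Suc j + i))) * (pseries p y)\<^sup>2 \<le> 0"
      using u_re(1)[OF *] by (simp add: mult_nonpos_nonneg)
    thus ?thesis using True u_re(2,3)[OF *] T_pos
      by (simp add: \<phi>_def e_def psq divide_nonpos_nonneg mult_nonneg_nonpos)
  next
    case False
    thus ?thesis using u_re(4)[of T] T_pos by (simp add: \<phi>_def eT_def)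
  qed
  note hyps = r \<phi>_cont \<phi>_le1
  interpret gs: gaussian_semigroup F a b c r
    using c_ne markov_avg_le1[OF hyps] borel_measurable_continuous_onI[OF continuous_markov_avg[OF hyps]]
    by unfold_locales (auto simp: F_def)
  have F_cont: "continuous_on UNIV F" unfolding F_def by (rule continuous_markov_avg[OF hyps])
  have F_le1: "norm (F y) \<le> 1" for y unfolding F_def by (rule markov_avg_le1[OF hyps])
  define g where "g = (\<lambda>t x. gauss_avg F (gs.drift t x) (sqrt (gs.var t)))"
  have avg: "markov_avg \<phi> r \<delta> m t x = g t x" if "0 \<le> t" "t \<le> r" for t x
    unfolding g_def gs.drift_def gs.var_def F_def by (rule markov_avg_eq_gauss_avg[OF hyps that])
  have prod_eq: "(\<Prod>i\<le>m. \<phi> i (X t x (r + real i * \<delta>) \<omega>))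
      = exp ((\<Sum>i\<in>{Suc j..<n}. e i (X t x (ti i) \<omega>)) + eT (X t x T \<omega>))" for t x \<omega>
  proof -
    have "(\<Prod>i\<le>m. \<phi> i (X t x (r + real i * \<delta>) \<omega>))
        = (\<Prod>i<m. \<phi> i (X t x (r + real i * \<delta>) \<omega>)) * \<phi> m (X t x (r + real m * \<delta>) \<omega>)"
      by (simp flip: lessThan_Suc_atMost)
    moreover have "\<phi> m (X t x (r + real m * \<delta>) \<omega>) = exp (eT (X t x T \<omega>))"
      unfolding time using j_lt ti_n by (simp add: \<phi>_def m_def)
    moreover have "(\<Prod>i<m. \<phi> i (X t x (r + real i * \<delta>) \<omega>)) = (\<Prod>i<m. exp (e (Suc j + i) (X t x (ti (Suc j + i)) \<omega>)))"
      unfolding time by (intro prod.cong refl) (auto simp: \<phi>_def m_def)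
    moreover have "\<dots> = exp (\<Sum>i<m. e (Suc j + i) (X t x (ti (Suc j + i)) \<omega>))"
      by (simp add: exp_sum)
    moreover have "(\<Sum>i<m. e (Suc j + i) (X t x (ti (Suc j + i)) \<omega>)) = (\<Sum>i\<in>{Suc j..<n}. e i (X t x (ti i) \<omega>))"
      unfolding m_def by (subst sum.atLeastLessThan_shift_0) (simp add: atLeast0LessThan)
    ultimately show ?thesis by (simp add: exp_add)
  qed
  have f_sum: "f t x = (\<integral>\<omega>. exp ((\<Sum>i\<in>{i. i < n \<and> t \<le> ti i}. e i (X t x (ti i) \<omega>)) + eT (X t x T \<omega>)) \<partial>M)" for t x
    unfolding f_def e_def eT_def ti_def ..
  have f_eq: "f t x = g t x" if t: "t \<in> {ti j<..r}" for t x
  proof -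
    \<comment> \<open>The atom at \<open>ti j\<close> has been passed, while one at \<open>r\<close>
      (if \<open>Suc j < n\<close>) still counts even for \<open>t = r\<close>; hence the interval
      closed on the right.\<close>
    have "{i. i < n \<and> t \<le> ti i} = {Suc j..<n}"
    proof (intro set_eqI iffI)
      fix i assume "i \<in> {i. i < n \<and> t \<le> ti i}"
      hence "ti j < ti i" "i < n" using t by auto
      thus "i \<in> {Suc j..<n}" by (simp add: ti_less_iff)
    next
      fix i assume i: "i \<in> {Suc j..<n}"
      hence "r \<le> ti i" unfolding r_def ti_le_iff by simp
      thus "i \<in> {i. i < n \<and> t \<le> ti i}" using t i by auto
    qed
    hence "f t x = markov_avg \<phi> r \<delta> m t x"
      unfolding f_sum markov_avg_def prod_eq by simp
    also have "\<dots> = g t x" using t ti_in[of j] j_lt by (intro avg) auto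
    finally show ?thesis .
  qed
  \<comment> \<open>At \<open>ti j\<close> itself the sum gains the term \<open>i = j\<close>. Its
    state is almost surely \<open>x\<close>, so the term leaves the expectation as the jump
    factor.\<close>
  have f_tj: "f (ti j) x = exp (e j x) * g (ti j) x" for x
  proof -
    have tj: "ti j \<in> {0..T}" using ti_in[of j] j_lt by simp
    have set: "{i. i < n \<and> ti j \<le> ti i} = insert j {Suc j..<n}"
      unfolding ti_le_iff using j_lt by auto
    have "f (ti j) x = (\<integral>\<omega>. exp (e j (X (ti j) x (ti j) \<omega>)) * (\<Prod>i\<le>m. \<phi> i (X (ti j) x (r + real i * \<delta>) \<omega>)) \<partial>M)"
      unfolding f_sum set prod_eq by (simp add: exp_add mult.assoc)
    also have "\<dots> = (\<integral>\<omega>. exp (e j x) * (\<Prod>i\<le>m. \<phi> i (X (ti j) x (r + real i * \<delta>) \<omega>)) \<partial>M)"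
    proof (rule integral_cong_AE)
      have "continuous_on UNIV (\<lambda>x. exp (e j x))"
        unfolding e_def psq by (intro continuous_intros continuous_pseries p_negl)
      hence E: "(\<lambda>x. exp (e j x)) \<in> borel_measurable borel"
        by (rule borel_measurable_continuous_onI)
      have P: "(\<lambda>\<omega>. \<Prod>i\<le>m. \<phi> i (X (ti j) x (r + real i * \<delta>) \<omega>)) \<in> borel_measurable M"
        unfolding time
      proof (intro borel_measurable_prod measurable_compose[OF _ borel_measurable_continuous_onI[OF \<phi>_cont]] X_meas tj)
        fix i assume "i \<in> {..m}"
        hence "Suc j + i \<le> n" using j_lt by (auto simp: m_def)
        from ti_in[OF this] show "ti (Suc j + i) \<in> {ti j..T}" by (simp add: ti_le_iff)
      qed
      show "(\<lambda>\<omega>. exp (e j (X (ti j) x (ti j) \<omega>)) * (\<Prod>i\<le>m. \<phi> i (X (ti j) x (r + real i * \<delta>) \<omega>))) \<in> borel_measurable M"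
        using tj by (intro borel_measurable_times P measurable_compose[OF X_meas E]) auto
      show "(\<lambda>\<omega>. exp (e j x) * (\<Prod>i\<le>m. \<phi> i (X (ti j) x (r + real i * \<delta>) \<omega>))) \<in> borel_measurable M"
        by (intro borel_measurable_times P) auto
      from X_start[OF tj, of x]
      show "AE \<omega> in M. exp (e j (X (ti j) x (ti j) \<omega>)) * (\<Prod>i\<le>m. \<phi> i (X (ti j) x (r + real i * \<delta>) \<omega>))
          = exp (e j x) * (\<Prod>i\<le>m. \<phi> i (X (ti j) x (r + real i * \<delta>) \<omega>))"
        by eventually_elim simp
    qed
    also have "\<dots> = exp (e j x) * markov_avg \<phi> r \<delta> m (ti j) x"
      unfolding markov_avg_def by simp
    also have "markov_avg \<phi> r \<delta> m (ti j) x = g (ti j) x"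
      using tj by (intro avg) (auto simp: r_def ti_le_iff)
    finally show ?thesis .
  qed
  \<comment> \<open>The formula is continuous on the whole plane, even past \<open>r\<close>:
    \<open>sqrt\<close> extends oddly to negative arguments, and \<open>gauss_avg\<close> accepts
    every real \<sigma>.\<close>
  have g_cont: "continuous_on UNIV (\<lambda>(t, x). g t x)"
  proof -
    have "continuous_on UNIV (\<lambda>z. (\<lambda>(m, \<sigma>). gauss_avg F m \<sigma>) (gs.drift (fst z) (snd z), sqrt (gs.var (fst z))))"
      by (rule continuous_on_compose2[OF continuous_gauss_avg[OF F_cont F_le1]])
         (auto simp: gs.drift_def gs.var_def intro!: continuous_intros)
    thus ?thesis by (simp add: g_def case_prod_unfold)
  qed
  have sg: "\<And>t x. t \<in> {ti j<..<r} \<Longrightarrow> f t x = gauss_avg F (gs.drift t x) (sqrt (gs.var t))"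
    using f_eq by (simp add: g_def)
  have "continuous_on ({ti j<..r} \<times> UNIV) (\<lambda>(t, x). f t x)"
    by (rule continuous_on_eq[OF continuous_on_subset[OF g_cont]]) (auto simp: f_eq)
  moreover have "((\<lambda>s. f s x) \<longlongrightarrow> f (ti j) x * exp (- complex_of_real (T / real n) *
        (u1 (ti j) * complex_of_real (pseries (pseries_sq p) x)
       + u2 (ti j) * complex_of_real (pseries p2 x)
       + u3 (ti j) * complex_of_real (pseries p3 x)))) (at_right (ti j))" for x
  proof -
    have "continuous_on UNIV (\<lambda>s. (\<lambda>(t, x). g t x) (s, x))"
      by (rule continuous_on_compose2[OF g_cont]) (auto intro!: continuous_intros)
    hence "((\<lambda>s. g s x) \<longlongrightarrow> g (ti j) x) (at_right (ti j))"
      by (auto simp: continuous_on_eq_continuous_at isCont_def intro: tendsto_mono[OF at_le])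
    moreover have "\<forall>\<^sub>F s in at_right (ti j). g s x = f s x"
      unfolding eventually_at_right_field using ti_less_iff[of j "Suc j"] f_eq
      by (intro exI[of _ r]) (auto simp: r_def)
    ultimately have "((\<lambda>s. f s x) \<longlongrightarrow> g (ti j) x) (at_right (ti j))"
      by (rule Lim_transform_eventually)
    moreover have "f (ti j) x * exp (- e j x) = g (ti j) x"
      unfolding f_tj by (simp add: exp_minus field_simps)
    ultimately show ?thesis by (simp add: e_def)
  qed
  moreover have "f T x = exp (v T * complex_of_real (pseries q x))" for x
  proof -
    have T: "T \<in> {0..T}" using T_pos by simp
    \<comment> \<open>The last atom sits at (n - 1) T / n, so only the terminal factor remains at
      \<open>T\<close>.\<close>
    have empty: "{i. i < n \<and> T \<le> ti i} = {}"
      using ti_le_iff[of n] unfolding ti_n by auto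
    have "f T x = (\<integral>\<omega>. exp (eT (X T x T \<omega>)) \<partial>M)" unfolding f_sum empty by simp
    also have "\<dots> = (\<integral>\<omega>. exp (eT x) \<partial>M)"
    proof (rule integral_cong_AE)
      have "continuous_on UNIV (\<lambda>x. exp (eT x))"
        unfolding eT_def by (intro continuous_intros continuous_pseries p_negl)
      from measurable_compose[OF X_meas borel_measurable_continuous_onI[OF this]] T
      show "(\<lambda>\<omega>. exp (eT (X T x T \<omega>))) \<in> borel_measurable M" by auto
      from X_start[OF T, of x] show "AE \<omega> in M. exp (eT (X T x T \<omega>)) = exp (eT x)"
        by eventually_elim simp
    qed simp
    finally show ?thesis by (simp add: eT_def prob_space)
  qed
  ultimately show ?thesis
    using gs.semigroup_C1_in_t[OF sg] gs.semigroup_Cinf_in_x[OF sg] gs.semigroup_pde[OF sg]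
    unfolding r_def ti_def by blast
qed

end
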